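(* Let $k \geq 1$ be an integer. (1) Let $\mathbb{Q}_k$ be the field obtained from $\mathbb{Q}$ by adjoining the roots (in an algebraic closure of $\mathbb{Q}$) of every polynomial with rational coefficients of degree at most $k$. Then $\mathbb{Q}_k$ and all of its finite extensions are rootless. (2) Let $S$ be any set of prime numbers, and let $L$ be the field obtained from $\mathbb{Q}$ by adjoining the $k$-th roots of all elements of $S$. Then $L$ and all of its finite extensions are rootless. Moreover, these fields are all of good heredity.
   Context: Let $F$ be a field with algebraic closure $F^{alg}$. A polynomial $P \in F[x]$ is hereditarily irreducible over $F$ if for every integer $n\ge 1$ the polynomial $P(x^n)$ is irreducible over $F$. A polynomial $P\in F[x]$ has good heredity (over $F$) if for some integer $n \geq 1$ the polynomial $P(x^n)$ factors (up to a nonzero constant) as a product of polynomials in $F[x]$ that are hereditarily irreducible over $F$. The field $F$ has good heredity if every polynomial $P \in F[x]$, none of whose roots in $F^{alg}$ is zero or a root of unity, has good heredity over $F$. An element $a \in F$ that is not a root of unity is rootless (in $F$) if for all but finitely many integers $n\ge 1$ the equation $x^n = a$ has no solution in $F$. The field $F$ is rootless if every nonzero $f \in F$ that is not a root of unity is rootless in $F$. *)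

theory Defs
  imports "HOL-Algebra.Algebraic_Closure_Type" "HOL-Algebra.Generated_Fields"
begin

text \<open>
  All fields are subfields \<open>F\<close> of an algebraically closed field, given by its type \<open>'a\<close>.
  The algebraic closure of \<open>F\<close> is then the set of elements of \<open>'a\<close> that are algebraic over \<open>F\<close>;
  it contains every root in \<open>'a\<close> of every nonzero polynomial over \<open>F\<close>.
  Since \<open>'a\<close> is arbitrary, restricting finite extensions of \<open>F\<close> to those inside \<open>'a\<close> loses nothing:
  every finite extension of \<open>F\<close> embeds over \<open>F\<close> into an algebraically closed field containing \<open>F\<close>.
\<close>

abbreviation ambient :: "'a::field ring"
  where "ambient \<equiv> ring_of_type_algebra"

definition polys_over :: "'a::field set \<Rightarrow> 'a poly ring"
  where "polys_over F = ring_of_type_algebra \<lparr> carrier := {P. \<forall>i. Polynomial.coeff P i \<in> F} \<rparr>"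

definition irreducible_over :: "'a::field set \<Rightarrow> 'a poly \<Rightarrow> bool"
  where "irreducible_over F P \<longleftrightarrow>
    P \<in> carrier (polys_over F) \<and> ring_irreducible\<^bsub>polys_over F\<^esub> P"

text \<open>The polynomial \<open>P(x\<^sup>n)\<close>.\<close>

definition subst_power :: "'a::field poly \<Rightarrow> nat \<Rightarrow> 'a poly"
  where "subst_power P n = pcompose P (Polynomial.monom 1 n)"

definition root_of_unity :: "'a::field \<Rightarrow> bool"
  where "root_of_unity z \<longleftrightarrow> (\<exists>n\<ge>1::nat. z ^ n = 1)"

definition hereditarily_irreducible :: "'a::field set \<Rightarrow> 'a poly \<Rightarrow> bool"
  where "hereditarily_irreducible F P \<longleftrightarrow> (\<forall>n\<ge>1. irreducible_over F (subst_power P n))"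

definition poly_good_heredity :: "'a::field set \<Rightarrow> 'a poly \<Rightarrow> bool"
  where "poly_good_heredity F P \<longleftrightarrow>
    (\<exists>n\<ge>1. \<exists>c\<in>F. c \<noteq> 0 \<and> (\<exists>Qs. (\<forall>Q\<in>set Qs. hereditarily_irreducible F Q) \<and>
       subst_power P n = Polynomial.smult c (prod_list Qs)))"

text \<open>The zero polynomial is excluded below because it vanishes at \<open>0\<close>.\<close>

definition field_good_heredity :: "'a::alg_closed_field set \<Rightarrow> bool"
  where "field_good_heredity F \<longleftrightarrow>
    (\<forall>P\<in>carrier (polys_over F).
       (\<forall>z. poly P z = 0 \<longrightarrow> z \<noteq> 0 \<and> \<not> root_of_unity z) \<longrightarrow> poly_good_heredity F P)"

definition rootless_elem :: "'a::field set \<Rightarrow> 'a \<Rightarrow> bool"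
  where "rootless_elem F a \<longleftrightarrow> finite {n::nat. n \<ge> 1 \<and> (\<exists>x\<in>F. x ^ n = a)}"

definition rootless_field :: "'a::field set \<Rightarrow> bool"
  where "rootless_field F \<longleftrightarrow>
    (\<forall>f\<in>F. f \<noteq> 0 \<and> \<not> root_of_unity f \<longrightarrow> rootless_elem F f)"

definition finite_extension :: "'a::field set \<Rightarrow> 'a set \<Rightarrow> bool"
  where "finite_extension K E \<longleftrightarrow>
    subfield K ambient \<and> subfield E ambient \<and> K \<subseteq> E \<and> ring.finite_dimension ambient K E"

definition adjoin_rat :: "'a::field_char_0 set \<Rightarrow> 'a set"
  where "adjoin_rat A = generate_field ambient (\<rat> \<union> A)"

definition bounded_degree_field :: "nat \<Rightarrow> 'a::field_char_0 set"
  where "bounded_degree_field k =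
    adjoin_rat {x. \<exists>p::rat poly. p \<noteq> 0 \<and> Polynomial.degree p \<le> k \<and> poly (map_poly of_rat p) x = 0}"

text \<open>All \<open>k\<close>-th roots of the elements of \<open>S\<close> are adjoined, not just one for each element.\<close>

definition radical_field :: "nat \<Rightarrow> nat set \<Rightarrow> 'a::field_char_0 set"
  where "radical_field k S = adjoin_rat {x. \<exists>p\<in>S. x ^ k = of_nat p}"

end

theory Submission
  imports Defs
begin

text \<open>
  Let \<open>M\<^sub>k\<close> be the field generated over \<open>\<rat>\<close> by all numbers of degree at most \<open>k\<close>. Every field of the
  theorem lies in some \<open>M\<^sub>l\<close>: a \<open>k\<close>-th root of an integer has degree at most \<open>k\<close>, and the finitely many
  algebraic elements that generate a finite extension have a common degree bound. So it suffices
  to treat subfields of the \<open>M\<^sub>l\<close>.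

  The key statement, \<open>bounded_degree_field_radically_bounded\<close>, says that an element \<open>\<alpha>\<close> of \<open>M\<^sub>k\<close>
  that is neither zero nor a root of unity is, up to roots of unity, an \<open>e\<close>-th power in \<open>M\<^sub>k\<close> only for
  boundedly many \<open>e\<close>. Here is why. The field \<open>M\<^sub>k\<close> is normal over \<open>\<rat>\<close>, and its automorphisms permute
  the roots of each polynomial of degree at most \<open>k\<close>, so their \<open>k!\<close>-th iterates are trivial
  (\<open>bounded_degree_field_normal\<close>). A root of unity \<open>\<zeta>\<close> of prime power order \<open>l\<^sup>a\<close> is conjugate to each
  \<open>\<zeta>\<^sup>u\<close> with \<open>u\<close> prime to \<open>l\<close>. Hence \<open>l\<^sup>a\<close> divides \<open>u\<^bsup>k!\<^esup> - 1\<close> if \<open>\<zeta>\<close> lies in \<open>M\<^sub>k\<close>, and a single exponent \<open>w\<close>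
  annihilates all roots of unity in \<open>M\<^sub>k\<close> (\<open>bounded_degree_field_torsion\<close>). If now \<open>\<gamma>\<^sup>e = \<zeta> \<alpha>\<close> with a
  root of unity \<open>\<zeta>\<close>, then an automorphism over \<open>\<rat>(\<alpha>)\<close> changes \<open>\<gamma>\<close> only by a root of unity. So it
  fixes \<open>\<gamma>\<^sup>w\<close>, and \<open>\<gamma>\<^sup>w\<close> lies in the number field \<open>\<rat>(\<alpha>)\<close>. There Northcott's argument applies: the roots
  of bounded degree of all orders of one number have bounded height, so that there are only finitely
  many of them (\<open>bounded_degree_exponents\<close>).

  Rootlessness is the case without roots of unity. For good heredity, let \<open>Q\<close> be a nonconstant
  factor of \<open>P(x\<^sup>n)\<close>, and let \<open>M\<^sub>l\<close> contain the coefficients and the roots of \<open>P\<close>. A root \<open>\<beta>\<close> of \<open>Q\<close>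
  satisfies \<open>\<beta>\<^sup>n = \<alpha>\<close> for a root \<open>\<alpha>\<close> of \<open>P\<close>. If \<open>\<beta>\<close> has degree \<open>d\<close> over \<open>M\<^sub>l\<close>, then the norm \<open>c\<close> of \<open>\<beta>\<close> satisfies
  \<open>c\<^sup>n = \<alpha>\<^sup>d\<close> up to sign, so \<open>\<alpha>\<close> is up to torsion a power with exponent \<open>n / gcd d n\<close>. By the key
  statement \<open>d\<close>, and with it the degree of \<open>Q\<close>, is at least a fixed fraction of \<open>n\<close>
  (\<open>factor_degree_bound\<close>). The number of factors of \<open>P(x\<^sup>n)\<close> is therefore bounded independently
  of \<open>n\<close>, and for an \<open>n\<close> with the largest number of factors each of them stays irreducible under all
  further substitutions (\<open>poly_good_heredityI\<close>).
\<close>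

abbreviation ipoly :: "int poly \<Rightarrow> 'a::field_char_0 \<Rightarrow> 'a"
  where "ipoly p x \<equiv> poly (map_poly of_int p) x"

section \<open>Subfields of a field given by its type\<close>

lemma ambient_simps [simp]:
  "carrier (ambient :: 'a::field ring) = UNIV"
  "x \<oplus>\<^bsub>ambient\<^esub> y = x + (y::'a)" "x \<otimes>\<^bsub>ambient\<^esub> y = x * (y::'a)"
  "\<zero>\<^bsub>ambient\<^esub> = (0::'a)" "\<one>\<^bsub>ambient\<^esub> = (1::'a)"
  by (simp_all add: ring_of_type_algebra_def)

lemma ambient_a_inv [simp]: "\<ominus>\<^bsub>ambient\<^esub> x = - (x::'a::field)"
proof -
  interpret cring "ambient :: 'a ring" by rule
  show ?thesis by (rule minus_equality) simp_all
qed

lemma ambient_m_inv [simp]: "x \<noteq> 0 \<Longrightarrow> inv\<^bsub>ambient\<^esub> x = inverse (x::'a::field)"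
proof -
  interpret cring "ambient :: 'a ring" by rule
  assume "x \<noteq> 0"
  then show ?thesis by (intro comm_inv_char) simp_all
qed

text \<open>The closure properties of \<^term>\<open>subfield K ambient\<close>, written with the operations of the type
so that the simplifier can use them.\<close>
locale subfield_ops =
  fixes K :: "'a::field set"
  assumes zero_mem [simp]: "0 \<in> K"
    and one_mem [simp]: "1 \<in> K"
    and add_mem [simp]: "x \<in> K \<Longrightarrow> y \<in> K \<Longrightarrow> x + y \<in> K"
    and uminus_mem [simp]: "x \<in> K \<Longrightarrow> - x \<in> K"
    and mult_mem [simp]: "x \<in> K \<Longrightarrow> y \<in> K \<Longrightarrow> x * y \<in> K"
    and inverse_mem [simp]: "x \<in> K \<Longrightarrow> inverse x \<in> K"
begin

lemma diff_mem [simp]: "x \<in> K \<Longrightarrow> y \<in> K \<Longrightarrow> x - y \<in> K"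
  using add_mem[of x "- y"] by auto

lemma divide_mem [simp]: "x \<in> K \<Longrightarrow> y \<in> K \<Longrightarrow> x / y \<in> K"
  by (simp add: divide_inverse)

lemma power_mem [simp]: "x \<in> K \<Longrightarrow> x ^ n \<in> K"
  by (induction n) auto

lemma sum_mem [simp]: "(\<And>i. i \<in> I \<Longrightarrow> f i \<in> K) \<Longrightarrow> sum f I \<in> K"
  by (induction I rule: infinite_finite_induct) auto

lemma of_nat_mem [simp]: "of_nat n \<in> K"
  by (induction n) auto

lemma of_int_mem [simp]: "of_int n \<in> K"
  by (cases n rule: int_cases2) auto

lemma subfield: "subfield K ambient"
proof -
  interpret field "ambient :: 'a ring" by rule
  show ?thesis by (intro subfieldI' subringI) auto
qed

end

lemma subfield_iff_ops: "subfield K ambient \<longleftrightarrow> subfield_ops (K :: 'a::field set)"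
proof
  interpret field "ambient :: 'a ring" by rule
  assume sf: "subfield K ambient"
  then have sr: "subring K ambient" by (rule subfieldE)
  have inv: "inverse x \<in> K" if "x \<in> K" for x
    using subfield_m_inv(1)[OF sf, of x] that by (cases "x = 0") auto
  show "subfield_ops K"
    using subringE[OF sr] inv by unfold_locales auto
qed (rule subfield_ops.subfield)


definition polys :: "'a::zero set \<Rightarrow> 'a poly set"
  where "polys K = {p. \<forall>i. coeff p i \<in> K}"

lemma polys_coeff: "p \<in> polys K \<Longrightarrow> coeff p i \<in> K"
  by (simp add: polys_def)

lemma polys_mono: "K \<subseteq> L \<Longrightarrow> p \<in> polys K \<Longrightarrow> p \<in> polys L"
  by (auto simp: polys_def)

context subfield_ops
begin

lemma polys_0 [simp]: "0 \<in> polys K"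
  and polys_1 [simp]: "1 \<in> polys K"
  by (auto simp: polys_def coeff_pCons split: nat.splits)

lemma polys_add [simp]: "p \<in> polys K \<Longrightarrow> q \<in> polys K \<Longrightarrow> p + q \<in> polys K"
  and polys_diff [simp]: "p \<in> polys K \<Longrightarrow> q \<in> polys K \<Longrightarrow> p - q \<in> polys K"
  and polys_uminus [simp]: "p \<in> polys K \<Longrightarrow> - p \<in> polys K"
  and polys_smult [simp]: "c \<in> K \<Longrightarrow> p \<in> polys K \<Longrightarrow> smult c p \<in> polys K"
  and polys_monom [simp]: "c \<in> K \<Longrightarrow> monom c n \<in> polys K"
  and polys_pCons: "c \<in> K \<Longrightarrow> p \<in> polys K \<Longrightarrow> pCons c p \<in> polys K"
  and polys_mult [simp]: "p \<in> polys K \<Longrightarrow> q \<in> polys K \<Longrightarrow> p * q \<in> polys K"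
  by (auto simp: polys_def coeff_mult coeff_pCons split: nat.splits)

lemma polys_pderiv [simp]: "p \<in> polys K \<Longrightarrow> pderiv p \<in> polys K"
  by (auto simp: polys_def coeff_pderiv simp del: of_nat_Suc)

lemma polys_power [simp]: "p \<in> polys K \<Longrightarrow> p ^ n \<in> polys K"
  by (induction n) auto

lemma polys_of_int [simp]: "map_poly of_int p \<in> polys K"
  by (auto simp: polys_def coeff_map_poly)

lemma poly_mem [simp]: "p \<in> polys K \<Longrightarrow> x \<in> K \<Longrightarrow> poly p x \<in> K"
  by (auto simp: poly_altdef polys_coeff)

lemma polys_pCons_iff [simp]: "pCons c p \<in> polys K \<longleftrightarrow> c \<in> K \<and> p \<in> polys K"
proof
  assume *: "pCons c p \<in> polys K"
  have "coeff p i \<in> K" for i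
    using polys_coeff[OF *, of "Suc i"] by simp
  then show "c \<in> K \<and> p \<in> polys K"
    using polys_coeff[OF *, of 0] by (simp add: polys_def)
qed (simp add: polys_pCons)

lemma polys_pcompose [simp]: "p \<in> polys K \<Longrightarrow> q \<in> polys K \<Longrightarrow> pcompose p q \<in> polys K"
proof (induction p)
  case (pCons a p)
  then have "a \<in> K" "pcompose p q \<in> polys K" by (simp_all add: polys_pCons_iff)
  then show ?case
    using pCons.prems by (simp add: pcompose_pCons polys_add polys_mult polys_pCons)
qed simp

text \<open>Division with remainder stays inside the subfield, because it only divides by the leading
  coefficient of the divisor.\<close>
lemma polys_division:
  assumes "f \<in> polys K" "f \<noteq> 0" "p \<in> polys K"
  shows "\<exists>q\<in>polys K. \<exists>r\<in>polys K. p = f * q + r \<and> (r = 0 \<or> degree r < degree f)"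
  using assms(3)
proof (induction "degree p" arbitrary: p rule: less_induct)
  case less
  show ?case
  proof (cases "p = 0 \<or> degree p < degree f")
    case True
    then show ?thesis using less.prems by (intro bexI[of _ 0] bexI[of _ p]) auto
  next
    case False
    then have le: "degree f \<le> degree p" and p0: "p \<noteq> 0" by auto
    define m where "m = monom (lead_coeff p / lead_coeff f) (degree p - degree f)"
    define p' where "p' = p - f * m"
    have m: "m \<in> polys K" unfolding m_def using assms less.prems by (simp add: polys_coeff)
    then have p': "p' \<in> polys K" unfolding p'_def using assms less.prems by auto
    have mn: "m \<noteq> 0" using p0 assms by (simp add: m_def)
    have deg: "degree (f * m) = degree p"
      using assms(2) le mn p0 by (simp add: degree_mult_eq m_def degree_monom_eq)
    have lc: "lead_coeff (f * m) = lead_coeff p"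
      using assms(2) by (simp add: lead_coeff_mult m_def degree_monom_eq p0)
    have "p' = 0 \<or> degree p' < degree p"
    proof (cases "degree p = 0")
      case True
      then have "degree p' = 0" "coeff p' 0 = 0"
        using deg lc degree_diff_le[of p 0 "f * m"] unfolding p'_def by auto
      then show ?thesis by (metis leading_coeff_0_iff)
    next
      case False
      have "degree p' \<le> degree p" unfolding p'_def using deg by (intro degree_diff_le) auto
      moreover have "coeff p' (degree p) = 0" unfolding p'_def using lc deg by simp
      ultimately show ?thesis
        using False by (metis le_neq_implies_less leading_coeff_0_iff)
    qed
    then have "\<exists>q\<in>polys K. \<exists>r\<in>polys K. p' = f * q + r \<and> (r = 0 \<or> degree r < degree f)"
    proof
      assume "p' = 0"
      then show ?thesis by (intro bexI[of _ 0]) simp_all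
    qed (rule less.hyps[OF _ p'])
    then obtain q r where qr: "q \<in> polys K" "r \<in> polys K" "p' = f * q + r"
        "r = 0 \<or> degree r < degree f"
      by blast
    have "p = p' + f * m" by (simp add: p'_def)
    also have "\<dots> = f * (q + m) + r" by (simp add: qr(3) distrib_left)
    finally have "p = f * (q + m) + r" .
    moreover have "q + m \<in> polys K" using qr(1) m by simp
    ultimately show ?thesis using qr(2,4) by metis
  qed
qed

end

definition alg_over :: "'a::field set \<Rightarrow> 'a \<Rightarrow> bool"
  where "alg_over K x \<longleftrightarrow> (\<exists>p\<in>polys K. p \<noteq> 0 \<and> poly p x = 0)"

definition is_minpoly :: "'a::field set \<Rightarrow> 'a \<Rightarrow> 'a poly \<Rightarrow> bool"
  where "is_minpoly K x f \<longleftrightarrow> f \<in> polys K \<and> lead_coeff f = 1 \<and> poly f x = 0 \<and>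
    (\<forall>p\<in>polys K. poly p x = 0 \<longrightarrow> (\<exists>q\<in>polys K. p = f * q))"

text \<open>A nonzero polynomial of least degree that vanishes at \<open>x\<close> divides all others, because the
remainder of a division by it vanishes at \<open>x\<close> too.\<close>
lemma (in subfield_ops) minpoly_exists:
  assumes "alg_over K x"
  shows "\<exists>f. is_minpoly K x f"
proof -
  define P where "P = (\<lambda>p. p \<in> polys K \<and> p \<noteq> 0 \<and> poly p x = 0)"
  have "\<exists>p. P p" using assms by (auto simp: alg_over_def P_def)
  then obtain g where g: "P g" and min: "\<And>p. P p \<Longrightarrow> degree g \<le> degree p"
    using ex_has_least_nat[of P _ degree] by blast
  define f where "f = smult (inverse (lead_coeff g)) g"
  have f: "f \<in> polys K" "lead_coeff f = 1" "poly f x = 0" "f \<noteq> 0" "degree f = degree g"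
    using g unfolding f_def P_def by (auto simp: polys_coeff)
  have "\<exists>q\<in>polys K. p = f * q" if p: "p \<in> polys K" "poly p x = 0" for p
  proof -
    obtain q r where qr: "q \<in> polys K" "r \<in> polys K" "p = f * q + r"
        "r = 0 \<or> degree r < degree f"
      using polys_division[OF f(1,4) p(1)] by blast
    have "poly r x = 0" using qr(3) p(2) f(3) by simp
    with min[of r] qr f(5) have "r = 0" by (force simp: P_def)
    with qr show ?thesis by auto
  qed
  with f show ?thesis by (auto simp: is_minpoly_def)
qed

section \<open>Algebraic numbers\<close>

interpretation rats: subfield_ops "\<rat> :: 'a::field_char_0 set"
  by unfold_locales auto

definition alg_deg_le :: "nat \<Rightarrow> 'a::field_char_0 \<Rightarrow> bool"
  where "alg_deg_le n x \<longleftrightarrow> (\<exists>p\<in>polys \<rat>. p \<noteq> 0 \<and> degree p \<le> n \<and> poly p x = 0)"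

lemma algebraic_iff_alg_over: "algebraic x \<longleftrightarrow> alg_over \<rat> x"
  by (auto simp: algebraic_altdef alg_over_def polys_def)

lemma algebraic_iff_alg_deg_le: "algebraic x \<longleftrightarrow> (\<exists>n. alg_deg_le n x)"
  by (auto simp: algebraic_iff_alg_over alg_over_def alg_deg_le_def)

lemma alg_deg_le_algebraic: "alg_deg_le n x \<Longrightarrow> algebraic x"
  by (auto simp: algebraic_iff_alg_deg_le)

lemma alg_deg_le_mono: "alg_deg_le m x \<Longrightarrow> m \<le> n \<Longrightarrow> alg_deg_le n x"
  unfolding alg_deg_le_def by (meson order_trans)

lemma polys_Rats_obtain:
  assumes "p \<in> polys (\<rat> :: 'a::field_char_0 set)"
  obtains q :: "rat poly" where "p = map_poly of_rat q" "degree q = degree p"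
proof
  define q where "q = map_poly (inv_into UNIV (of_rat :: rat \<Rightarrow> 'a)) p"
  have inv: "inv_into UNIV (of_rat :: rat \<Rightarrow> 'a) 0 = 0"
    using inv_into_f_f[of "of_rat :: rat \<Rightarrow> 'a" UNIV 0] by (simp add: inj_on_def)
  show eq: "p = map_poly of_rat q"
  proof (rule poly_eqI)
    fix i
    have "coeff p i \<in> range of_rat"
      using assms by (auto simp: polys_def Rats_def)
    then show "coeff p i = coeff (map_poly of_rat q) i"
      by (simp add: q_def coeff_map_poly inv f_inv_into_f)
  qed
  show "degree q = degree p"
    by (subst eq, rule degree_map_poly[symmetric]) simp
qed

lemma alg_deg_le_iff_rat_poly:
  "alg_deg_le n x \<longleftrightarrow> (\<exists>p::rat poly. p \<noteq> 0 \<and> degree p \<le> n \<and> poly (map_poly of_rat p) x = 0)"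
proof
  assume "alg_deg_le n x"
  then obtain p where p: "p \<in> polys \<rat>" "p \<noteq> 0" "degree p \<le> n" "poly p x = 0"
    by (auto simp: alg_deg_le_def)
  obtain q :: "rat poly" where q: "p = map_poly of_rat q" "degree q = degree p"
    using polys_Rats_obtain[OF p(1)] .
  with p show "\<exists>p::rat poly. p \<noteq> 0 \<and> degree p \<le> n \<and> poly (map_poly of_rat p) x = 0"
    by (intro exI[of _ q]) auto
next
  assume "\<exists>p::rat poly. p \<noteq> 0 \<and> degree p \<le> n \<and> poly (map_poly of_rat p) x = 0"
  then obtain p :: "rat poly" where p: "p \<noteq> 0" "degree p \<le> n" "poly (map_poly of_rat p) x = 0"
    by blast
  have "map_poly of_rat p \<noteq> (0 :: 'a poly)"
    using p(1) by (metis degree_map_poly coeff_map_poly leading_coeff_0_iff of_rat_0 of_rat_eq_0_iff coeff_0)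
  moreover have "map_poly of_rat p \<in> polys (\<rat> :: 'a set)"
    by (auto simp: polys_def coeff_map_poly)
  ultimately show "alg_deg_le n x"
    unfolding alg_deg_le_def using p by (intro bexI[of _ "map_poly of_rat p"]) (auto simp: degree_map_poly)
qed

interpretation ratvs: vector_space "\<lambda>(q::rat) (x::'a::field_char_0). of_rat q * x"
  by unfold_locales (simp_all add: algebra_simps of_rat_add of_rat_mult)

text \<open>If all \<open>x\<^sup>i t\<close> lie in the span of \<open>d\<close> elements, then the first \<open>d + 1\<close> of them are linearly
  dependent over \<open>\<rat>\<close>.\<close>
lemma alg_deg_le_span:
  fixes x t :: "'a::field_char_0"
  assumes T: "finite T" and t: "t \<noteq> 0" and span: "\<And>i. x ^ i * t \<in> ratvs.span T"
  shows "alg_deg_le (card T) x"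
proof (cases "inj_on (\<lambda>i. x ^ i * t) {..card T}")
  case False
  then obtain i j where ij: "i \<noteq> j" "i \<le> card T" "j \<le> card T" "x ^ i = x ^ j"
    using t by (auto simp: inj_on_def)
  define p :: "'a poly" where "p = monom 1 i - monom 1 j"
  have "coeff p i = 1" using ij by (simp add: p_def)
  then have "p \<noteq> 0" by auto
  moreover have "degree p \<le> card T"
    unfolding p_def using ij by (intro degree_diff_le order_trans[OF degree_monom_le])
  moreover have "p \<in> polys \<rat>" unfolding p_def by simp
  moreover have "poly p x = 0" unfolding p_def using ij by (simp add: poly_monom)
  ultimately show ?thesis unfolding alg_deg_le_def by blast
next
  case True
  define S where "S = (\<lambda>i. x ^ i * t) ` {..card T}"
  have "card S = Suc (card T)" unfolding S_def using True by (simp add: card_image)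
  moreover have "finite S" "S \<subseteq> ratvs.span T" using span by (auto simp: S_def)
  ultimately have "ratvs.dependent S"
    using ratvs.independent_span_bound[OF T, of S] by auto
  then obtain u v where u: "v \<in> S" "u v \<noteq> 0" "(\<Sum>v\<in>S. of_rat (u v) * v) = 0"
    using ratvs.dependent_finite[OF \<open>finite S\<close>] by auto
  define p where "p = (\<Sum>i\<le>card T. monom (of_rat (u (x ^ i * t)) :: 'a) i)"
  have coeff: "coeff p i = (if i \<le> card T then of_rat (u (x ^ i * t)) else 0)" for i
    unfolding p_def by (simp add: coeff_sum)
  have "p \<in> polys \<rat>" by (auto simp: polys_def coeff)
  moreover have "p \<noteq> 0"
    using u(1,2) coeff by (auto simp: S_def) (metis coeff_0 of_rat_eq_0_iff)
  moreover have "degree p \<le> card T" by (intro degree_le) (simp add: coeff)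
  moreover have "poly p x = 0"
  proof -
    have "poly p x * t = (\<Sum>i\<le>card T. of_rat (u (x ^ i * t)) * (x ^ i * t))"
      unfolding p_def by (simp add: poly_sum poly_monom sum_distrib_right mult.assoc)
    also have "\<dots> = 0"
      using u(3) True unfolding S_def by (simp add: sum.reindex)
    finally show ?thesis using t by simp
  qed
  ultimately show ?thesis unfolding alg_deg_le_def by blast
qed

text \<open>Multiplication by \<open>x\<close> maps the finite-dimensional space spanned by \<open>T\<close> into itself. The elements
with this property form a ring, and all of them are algebraic; this is how algebraic numbers are
seen to be closed under sums and products.\<close>
definition stabilizes :: "'a::field_char_0 set \<Rightarrow> 'a \<Rightarrow> bool"
  where "stabilizes T x \<longleftrightarrow> (\<forall>t\<in>T. x * t \<in> ratvs.span T)"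

lemma mult_span:
  assumes "\<And>t. t \<in> T \<Longrightarrow> x * t \<in> ratvs.span T'" "v \<in> ratvs.span T"
  shows "x * v \<in> ratvs.span T'"
  using assms(2)
proof (induction rule: ratvs.span_induct)
  case base
  show ?case
  proof (rule ratvs.subspaceI)
    fix c v assume "v \<in> {v. x * v \<in> ratvs.span T'}"
    then show "of_rat c * v \<in> {v. x * v \<in> ratvs.span T'}"
      using ratvs.span_scale[of "x * v" T' c] by (simp add: ac_simps)
  qed (auto simp: distrib_left intro: ratvs.span_add ratvs.span_zero)
qed (use assms(1) in auto)

lemma stabilizes_span: "stabilizes T x \<Longrightarrow> v \<in> ratvs.span T \<Longrightarrow> x * v \<in> ratvs.span T"
  by (rule mult_span) (auto simp: stabilizes_def)

lemma stabilizes_add: "stabilizes T x \<Longrightarrow> stabilizes T y \<Longrightarrow> stabilizes T (x + y)"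
  by (auto simp: stabilizes_def distrib_right intro: ratvs.span_add)

lemma stabilizes_mult: "stabilizes T x \<Longrightarrow> stabilizes T y \<Longrightarrow> stabilizes T (x * y)"
  using stabilizes_span[of T x] by (auto simp: stabilizes_def mult.assoc)

lemma stabilizes_Rats: "x \<in> \<rat> \<Longrightarrow> stabilizes T x"
  by (auto simp: stabilizes_def Rats_def intro: ratvs.span_scale ratvs.span_base)

lemma stabilizes_poly: "p \<in> polys \<rat> \<Longrightarrow> stabilizes T x \<Longrightarrow> stabilizes T (poly p x)"
  by (induction p) (auto intro!: stabilizes_add stabilizes_mult intro: stabilizes_Rats)

lemma stabilizes_imp_alg_deg_le:
  assumes "finite T" "1 \<in> T" "stabilizes T x"
  shows "alg_deg_le (card T) x"
proof (rule alg_deg_le_span[where t = 1])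
  show "x ^ i * 1 \<in> ratvs.span T" for i
    using assms by (induction i) (auto intro: ratvs.span_base stabilizes_span)
qed (use assms in auto)

text \<open>A finite-dimensional space that some elements stabilize stays finite-dimensional and stable
  after multiplication by the powers of an element \<open>x\<close> that is integral over the stabilizing
  elements.\<close>
lemma stabilizes_extend:
  assumes T: "finite T" "1 \<in> T" and C: "\<And>c. c \<in> C \<Longrightarrow> stabilizes T c"
    and d: "d \<ge> 1" and rel: "x ^ d = (\<Sum>j<d. a j * x ^ j)" and a: "\<And>j. j < d \<Longrightarrow> stabilizes T (a j)"
  shows "\<exists>T'. finite T' \<and> 1 \<in> T' \<and> (\<forall>c\<in>insert x C. stabilizes T' c)"
proof -
  define T' where "T' = (\<lambda>(t, i). t * x ^ i) ` (T \<times> {..<d})"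
  have base: "t * x ^ i \<in> T'" if "t \<in> T" "i < d" for t i
    using that by (force simp: T'_def)
  have span: "v * x ^ i \<in> ratvs.span T'" if "v \<in> ratvs.span T" "i < d" for v i
  proof -
    have "x ^ i * v \<in> ratvs.span T'"
      by (rule mult_span[OF _ that(1)], subst mult.commute) (intro ratvs.span_base base that(2))
    then show ?thesis by (simp add: mult.commute)
  qed
  have "stabilizes T' x"
    unfolding stabilizes_def
  proof
    fix s assume "s \<in> T'"
    then obtain t i where t: "t \<in> T" and i: "i < d" and s: "s = t * x ^ i"
      by (auto simp: T'_def)
    show "x * s \<in> ratvs.span T'"
    proof (cases "Suc i < d")
      case True
      then have "t * x ^ Suc i \<in> ratvs.span T'" by (intro span ratvs.span_base t)
      then show ?thesis by (simp add: s ac_simps)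
    next
      case False
      with i have "d = Suc i" by auto
      then have "x * s = t * x ^ d" by (simp add: s)
      also have "\<dots> = (\<Sum>j<d. (a j * t) * x ^ j)"
        unfolding rel by (simp add: sum_distrib_left ac_simps)
      also have "\<dots> \<in> ratvs.span T'"
        using a t by (intro ratvs.span_sum span) (auto simp: stabilizes_def)
      finally show ?thesis .
    qed
  qed
  moreover have "stabilizes T' c" if "c \<in> C" for c
    unfolding stabilizes_def
  proof
    fix s assume "s \<in> T'"
    then obtain t i where t: "t \<in> T" and i: "i < d" and s: "s = t * x ^ i"
      by (auto simp: T'_def)
    have "(c * t) * x ^ i \<in> ratvs.span T'"
      using C[OF that] t i by (intro span) (auto simp: stabilizes_def)
    then show "c * s \<in> ratvs.span T'" by (simp add: s ac_simps)
  qed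
  moreover have "finite T'" "1 \<in> T'"
    using T d base[of 1 0] by (auto simp: T'_def)
  ultimately show ?thesis by blast
qed

lemma root_relation:
  fixes x :: "'a::field"
  assumes "p \<noteq> 0" "poly p x = 0"
  shows "degree p \<ge> 1" "x ^ degree p = (\<Sum>j<degree p. (- coeff p j / lead_coeff p) * x ^ j)"
proof -
  have "degree p \<noteq> 0"
  proof
    assume "degree p = 0"
    then obtain c where "p = [:c:]" by (rule degree_eq_zeroE)
    with assms show False by simp
  qed
  then show "degree p \<ge> 1" by simp
  have "0 = (\<Sum>j<Suc (degree p). coeff p j * x ^ j)"
    using assms(2) by (simp add: poly_altdef lessThan_Suc_atMost)
  then have "lead_coeff p * x ^ degree p = - (\<Sum>j<degree p. coeff p j * x ^ j)"
    by (simp add: eq_neg_iff_add_eq_0 add.commute)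
  then have "x ^ degree p = - (\<Sum>j<degree p. coeff p j * x ^ j) / lead_coeff p"
    using assms(1) by (simp add: field_simps)
  also have "\<dots> = (\<Sum>j<degree p. (- coeff p j / lead_coeff p) * x ^ j)"
    by (simp add: sum_divide_distrib sum_negf)
  finally show "x ^ degree p = (\<Sum>j<degree p. (- coeff p j / lead_coeff p) * x ^ j)" .
qed

lemma stabilizes_finite:
  assumes "finite C" "\<And>c. c \<in> C \<Longrightarrow> algebraic c"
  shows "\<exists>T. finite T \<and> 1 \<in> T \<and> (\<forall>c\<in>C. stabilizes T c)"
  using assms
proof (induction C rule: finite_induct)
  case empty
  show ?case by (intro exI[of _ "{1}"]) simp
next
  case (insert x C)
  then obtain T where T: "finite T" "1 \<in> T" "\<And>c. c \<in> C \<Longrightarrow> stabilizes T c" by auto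
  from insert.prems[of x] obtain p where p: "p \<in> polys \<rat>" "p \<noteq> 0" "poly p x = 0"
    by (auto simp: algebraic_iff_alg_over alg_over_def)
  show ?case
    by (rule stabilizes_extend[OF T root_relation[OF p(2,3)]])
      (use p(1) in \<open>auto intro!: stabilizes_Rats rats.divide_mem rats.uminus_mem polys_coeff\<close>)
qed

lemma algebraic_add: "algebraic x \<Longrightarrow> algebraic y \<Longrightarrow> algebraic (x + y)"
  and algebraic_mult: "algebraic x \<Longrightarrow> algebraic y \<Longrightarrow> algebraic (x * y)"
proof -
  assume "algebraic x" "algebraic y"
  then obtain T where "finite T" "1 \<in> T" "stabilizes T x" "stabilizes T y"
    using stabilizes_finite[of "{x, y}"] by auto
  then show "algebraic (x + y)" "algebraic (x * y)"
    using stabilizes_add stabilizes_mult stabilizes_imp_alg_deg_le alg_deg_le_algebraic by blast+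
qed

interpretation algebraics: subfield_ops "Collect algebraic :: 'a::field_char_0 set"
  by unfold_locales (auto intro: algebraic_add algebraic_mult)

text \<open>A polynomial with algebraic coefficients has algebraic roots: some finite-dimensional space is
stable under the finitely many coefficients, and it extends to one that is stable under the root.\<close>
lemma alg_over_algebraics:
  assumes "alg_over (Collect algebraic) x"
  shows "algebraic x"
proof -
  obtain p where p: "p \<in> polys (Collect algebraic)" "p \<noteq> 0" "poly p x = 0"
    using assms by (auto simp: alg_over_def)
  define a where "a = (\<lambda>j. - coeff p j / lead_coeff p)"
  have "algebraic (a j)" for j
    using algebraics.divide_mem[OF algebraics.uminus_mem[OF polys_coeff[OF p(1)]]
        polys_coeff[OF p(1)]] by (simp add: a_def)
  then obtain T where T: "finite T" "1 \<in> T" "\<And>c. c \<in> a ` {..<degree p} \<Longrightarrow> stabilizes T c"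
    using stabilizes_finite[of "a ` {..<degree p}"] by blast
  have rel: "x ^ degree p = (\<Sum>j<degree p. a j * x ^ j)"
    using root_relation(2)[OF p(2,3)] by (simp add: a_def)
  have "\<exists>T'. finite T' \<and> 1 \<in> T' \<and> (\<forall>c\<in>insert x (a ` {..<degree p}). stabilizes T' c)"
    by (rule stabilizes_extend[OF T root_relation(1)[OF p(2,3)] rel]) (simp_all add: T(3))
  then obtain T' where "finite T'" "1 \<in> T'" "stabilizes T' x" by auto
  then show ?thesis using stabilizes_imp_alg_deg_le alg_deg_le_algebraic by blast
qed

text \<open>Fewer than \<open>n + 1\<close> powers of \<open>x\<close> span a space that every rational polynomial in \<open>x\<close> stabilizes.\<close>
lemma alg_deg_le_poly:
  assumes "alg_deg_le n x" "g \<in> polys \<rat>"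
  shows "alg_deg_le n (poly g x)"
proof -
  obtain p where p: "p \<in> polys \<rat>" "p \<noteq> 0" "degree p \<le> n" "poly p x = 0"
    using assms(1) by (auto simp: alg_deg_le_def)
  define d where "d = degree p"
  have d: "d \<ge> 1" and rel: "x ^ d = (\<Sum>j<d. (- coeff p j / lead_coeff p) * x ^ j)"
    using root_relation[OF p(2,4)] by (auto simp: d_def)
  define T where "T = (\<lambda>i. x ^ i) ` {..<d}"
  have "stabilizes T x"
    unfolding stabilizes_def
  proof
    fix s assume "s \<in> T"
    then obtain i where i: "i < d" and s: "s = x ^ i"
      by (auto simp: T_def)
    show "x * s \<in> ratvs.span T"
    proof (cases "Suc i < d")
      case True
      then have "x ^ Suc i \<in> T" by (simp add: T_def del: power_Suc)
      then show ?thesis using ratvs.span_base[of "x ^ Suc i" T] by (simp add: s)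
    next
      case False
      with i have "d = Suc i" by simp
      then have "x * s = x ^ d" by (simp add: s)
      also have "\<dots> \<in> ratvs.span T"
        unfolding rel
      proof (rule ratvs.span_sum)
        fix j assume "j \<in> {..<d}"
        then have "x ^ j \<in> ratvs.span T" by (auto simp: T_def intro: ratvs.span_base)
        moreover have "- coeff p j / lead_coeff p \<in> \<rat>"
          using p(1) by (intro rats.divide_mem rats.uminus_mem polys_coeff)
        then obtain q where "- coeff p j / lead_coeff p = of_rat q" by (auto simp: Rats_def)
        ultimately show "- coeff p j / lead_coeff p * x ^ j \<in> ratvs.span T"
          by (simp add: ratvs.span_scale)
      qed
      finally show ?thesis .
    qed
  qed
  moreover have "finite T" "1 \<in> T" using d by (auto simp: T_def intro: image_eqI[of _ _ 0])
  ultimately have "alg_deg_le (card T) (poly g x)"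
    using assms(2) by (intro stabilizes_imp_alg_deg_le stabilizes_poly)
  moreover have "card T \<le> n"
    unfolding T_def using card_image_le[of "{..<d}" "\<lambda>i. x ^ i"] p(3) by (simp add: d_def)
  ultimately show ?thesis by (rule alg_deg_le_mono)
qed

section \<open>Fields generated by algebraic numbers\<close>

lemma adjoin_rat_ops: "subfield_ops (adjoin_rat A)"
proof -
  interpret field "ambient :: 'a ring" by rule
  show ?thesis
    unfolding adjoin_rat_def subfield_iff_ops[symmetric]
    by (rule generate_field_is_subfield) simp
qed

lemma adjoin_rat_Rats: "\<rat> \<subseteq> adjoin_rat A"
  and adjoin_rat_incl: "A \<subseteq> adjoin_rat A"
  by (auto simp: adjoin_rat_def intro: generate_field.incl)

lemma adjoin_rat_least:
  assumes "subfield_ops K" "A \<subseteq> K"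
  shows "adjoin_rat A \<subseteq> K"
proof -
  interpret K: subfield_ops K by fact
  interpret field "ambient :: 'a ring" by rule
  have "\<rat> \<subseteq> K"
  proof
    fix x :: 'a assume "x \<in> \<rat>"
    then obtain a b :: int where "x = of_int a / of_int b" by (rule Rats_cases')
    then show "x \<in> K" by simp
  qed
  then show ?thesis
    unfolding adjoin_rat_def using assms K.subfield by (intro generate_field_min_subfield1) auto
qed


lemma adjoin_rat_mono: "A \<subseteq> B \<Longrightarrow> adjoin_rat A \<subseteq> adjoin_rat B"
  by (intro adjoin_rat_least adjoin_rat_ops) (use adjoin_rat_incl in blast)

lemma adjoin_rat_algebraic: "(\<And>x. x \<in> A \<Longrightarrow> algebraic x) \<Longrightarrow> x \<in> adjoin_rat A \<Longrightarrow> algebraic x"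
  using adjoin_rat_least[OF algebraics.subfield_ops_axioms, of A] by blast

text \<open>The elements that are generated by finite parts of \<open>A\<close> form a field, since two finite parts have a
finite union.\<close>
lemma adjoin_rat_finite_support:
  assumes "x \<in> adjoin_rat A"
  shows "\<exists>B\<subseteq>A. finite B \<and> x \<in> adjoin_rat B"
proof -
  define U where "U = {x. \<exists>B\<subseteq>A. finite B \<and> x \<in> adjoin_rat B}"
  have bin: "h x y \<in> U" if x: "x \<in> U" and y: "y \<in> U"
    and h: "\<And>K x y. subfield_ops K \<Longrightarrow> x \<in> K \<Longrightarrow> y \<in> K \<Longrightarrow> h x y \<in> K" for h x y
  proof -
    obtain B where B: "B \<subseteq> A" "finite B" "x \<in> adjoin_rat B"
      using x by (auto simp: U_def)
    obtain C where C: "C \<subseteq> A" "finite C" "y \<in> adjoin_rat C"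
      using y by (auto simp: U_def)
    have "x \<in> adjoin_rat (B \<union> C)" "y \<in> adjoin_rat (B \<union> C)"
      using B(3) C(3) adjoin_rat_mono[of B "B \<union> C"] adjoin_rat_mono[of C "B \<union> C"] by auto
    then have "h x y \<in> adjoin_rat (B \<union> C)" by (intro h adjoin_rat_ops)
    with B C show ?thesis unfolding U_def by (intro CollectI exI[of _ "B \<union> C"]) auto
  qed
  have cst: "c \<in> U" if "\<And>K. subfield_ops K \<Longrightarrow> c \<in> K" for c
    unfolding U_def using that[OF adjoin_rat_ops] by blast
  have "subfield_ops U"
  proof
    show "0 \<in> U" "1 \<in> U" by (intro cst subfield_ops.zero_mem subfield_ops.one_mem; assumption)+
    show "x + y \<in> U" if "x \<in> U" "y \<in> U" for x y
      by (rule bin[of x y "(+)", OF that]) (rule subfield_ops.add_mem)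
    show "x * y \<in> U" if "x \<in> U" "y \<in> U" for x y
      by (rule bin[of x y "(*)", OF that]) (rule subfield_ops.mult_mem)
    show "- x \<in> U" if "x \<in> U" for x
      by (rule bin[of x x "\<lambda>x y. - x", OF that that]) (rule subfield_ops.uminus_mem)
    show "inverse x \<in> U" if "x \<in> U" for x
      by (rule bin[of x x "\<lambda>x y. inverse x", OF that that]) (rule subfield_ops.inverse_mem)
  qed
  moreover have "a \<in> U" if "a \<in> A" for a
    unfolding U_def using that adjoin_rat_incl[of "{a}"] by (intro CollectI exI[of _ "{a}"]) auto
  ultimately have "adjoin_rat A \<subseteq> U" by (intro adjoin_rat_least) auto
  with assms show ?thesis by (auto simp: U_def)
qed

lemma bounded_degree_field_eq: "bounded_degree_field k = adjoin_rat {x. alg_deg_le k x}"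
  unfolding bounded_degree_field_def alg_deg_le_iff_rat_poly ..

lemma bounded_degree_field_ops: "subfield_ops (bounded_degree_field k)"
  unfolding bounded_degree_field_eq by (rule adjoin_rat_ops)

lemma bounded_degree_field_mono: "k \<le> l \<Longrightarrow> bounded_degree_field k \<subseteq> bounded_degree_field l"
  unfolding bounded_degree_field_eq by (intro adjoin_rat_mono) (auto intro: alg_deg_le_mono)

lemma bounded_degree_field_algebraic: "x \<in> bounded_degree_field k \<Longrightarrow> algebraic x"
  unfolding bounded_degree_field_eq by (rule adjoin_rat_algebraic) (auto intro: alg_deg_le_algebraic)

text \<open>This absorption is the reason for working with all the fields \<^term>\<open>bounded_degree_field k\<close> at
once: they swallow finite extensions and splitting fields.\<close>
lemma algebraic_finite_set_in_bounded_degree_field: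
  assumes "finite A" "\<And>x. x \<in> A \<Longrightarrow> algebraic x"
  shows "\<exists>l\<ge>k. A \<subseteq> bounded_degree_field l"
  using assms
proof (induction A rule: finite_induct)
  case (insert x A)
  then obtain l where l: "l \<ge> k" "A \<subseteq> bounded_degree_field l" by auto
  obtain n where "alg_deg_le n x" using insert.prems[of x] by (auto simp: algebraic_iff_alg_deg_le)
  then have "x \<in> bounded_degree_field (max l n)"
    unfolding bounded_degree_field_eq using adjoin_rat_incl alg_deg_le_mono[of n x "max l n"] by fastforce
  moreover have "A \<subseteq> bounded_degree_field (max l n)"
    using l(2) bounded_degree_field_mono[of l "max l n"] by auto
  ultimately show ?case using l(1) by (intro exI[of _ "max l n"]) auto
qed auto

section \<open>Embeddings of fields of algebraic numbers\<close>


lemma is_minpolyD: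
  assumes "is_minpoly K x f"
  shows "f \<in> polys K" "lead_coeff f = 1" "poly f x = 0" "f \<noteq> 0"
    "\<And>p. p \<in> polys K \<Longrightarrow> poly p x = 0 \<Longrightarrow> \<exists>q\<in>polys K. p = f * q"
    "\<And>p. p \<in> polys K \<Longrightarrow> poly p x = 0 \<Longrightarrow> f dvd p"
proof -
  show 1: "f \<in> polys K" "lead_coeff f = 1" "poly f x = 0"
    and 2: "\<And>p. p \<in> polys K \<Longrightarrow> poly p x = 0 \<Longrightarrow> \<exists>q\<in>polys K. p = f * q"
    using assms unfolding is_minpoly_def by blast+
  show "f \<noteq> 0" using 1(2) by (intro notI) simp
  show "f dvd p" if "p \<in> polys K" "poly p x = 0" for p
    using 2[OF that] by (auto intro: dvdI)
qed

text \<open>The values of \<open>\<sigma>\<close> outside \<open>K\<close> are arbitrary, so an extension of \<open>\<sigma>\<close> to a larger field is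
another function that agrees with \<open>\<sigma>\<close> on \<open>K\<close>.\<close>
locale field_embedding = subfield_ops K
  for K :: "'a::field_char_0 set" +
  fixes \<sigma> :: "'a \<Rightarrow> 'a"
  assumes hom_one [simp]: "\<sigma> 1 = 1"
    and hom_add [simp]: "x \<in> K \<Longrightarrow> y \<in> K \<Longrightarrow> \<sigma> (x + y) = \<sigma> x + \<sigma> y"
    and hom_mult [simp]: "x \<in> K \<Longrightarrow> y \<in> K \<Longrightarrow> \<sigma> (x * y) = \<sigma> x * \<sigma> y"
begin

lemma hom_zero [simp]: "\<sigma> 0 = 0"
  using hom_add[of 0 0] by simp

lemma hom_uminus [simp]: "x \<in> K \<Longrightarrow> \<sigma> (- x) = - \<sigma> x"
  using hom_add[of x "- x"] by (simp add: eq_neg_iff_add_eq_0 add.commute)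

lemma hom_diff [simp]: "x \<in> K \<Longrightarrow> y \<in> K \<Longrightarrow> \<sigma> (x - y) = \<sigma> x - \<sigma> y"
  using hom_add[of x "- y"] by simp

lemma hom_inverse [simp]: "x \<in> K \<Longrightarrow> \<sigma> (inverse x) = inverse (\<sigma> x)"
proof (cases "x = 0")
  case False
  assume "x \<in> K"
  then have "\<sigma> x * \<sigma> (inverse x) = 1"
    using False hom_mult[of x "inverse x"] by simp
  then show ?thesis by (metis inverse_unique)
qed simp

lemma hom_eq_0_iff: "x \<in> K \<Longrightarrow> \<sigma> x = 0 \<longleftrightarrow> x = 0"
  using hom_mult[of x "inverse x"] by (cases "x = 0") auto

lemma hom_inj: "inj_on \<sigma> K"
proof (rule inj_onI)
  fix x y assume "x \<in> K" "y \<in> K" "\<sigma> x = \<sigma> y"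
  then have "\<sigma> (x - y) = 0" by simp
  then show "x = y" using hom_eq_0_iff[of "x - y"] \<open>x \<in> K\<close> \<open>y \<in> K\<close> by simp
qed

lemma hom_power [simp]: "x \<in> K \<Longrightarrow> \<sigma> (x ^ n) = \<sigma> x ^ n"
  by (induction n) auto

lemma hom_sum: "(\<And>i. i \<in> I \<Longrightarrow> f i \<in> K) \<Longrightarrow> \<sigma> (sum f I) = (\<Sum>i\<in>I. \<sigma> (f i))"
  by (induction I rule: infinite_finite_induct) auto

lemma coeff_hom_poly [simp]: "coeff (map_poly \<sigma> p) i = \<sigma> (coeff p i)"
  by (simp add: coeff_map_poly)

lemma hom_poly_add: "p \<in> polys K \<Longrightarrow> q \<in> polys K \<Longrightarrow> map_poly \<sigma> (p + q) = map_poly \<sigma> p + map_poly \<sigma> q"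
  by (rule poly_eqI) (simp add: polys_coeff)

lemma hom_poly_diff: "p \<in> polys K \<Longrightarrow> q \<in> polys K \<Longrightarrow> map_poly \<sigma> (p - q) = map_poly \<sigma> p - map_poly \<sigma> q"
  by (rule poly_eqI) (simp add: polys_coeff)

lemma hom_poly_mult: "p \<in> polys K \<Longrightarrow> q \<in> polys K \<Longrightarrow> map_poly \<sigma> (p * q) = map_poly \<sigma> p * map_poly \<sigma> q"
  by (rule poly_eqI) (simp add: polys_coeff coeff_mult hom_sum)

lemma hom_poly_eval: "p \<in> polys K \<Longrightarrow> x \<in> K \<Longrightarrow> \<sigma> (poly p x) = poly (map_poly \<sigma> p) (\<sigma> x)"
  by (induction p) (auto simp: map_poly_pCons)

lemma fixed_field: "subfield_ops {x\<in>K. \<sigma> x = x}"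
  by unfold_locales auto

lemma preimage_field:
  assumes "subfield_ops S"
  shows "subfield_ops {x\<in>K. \<sigma> x \<in> S}"
proof -
  interpret S: subfield_ops S by fact
  show ?thesis by unfold_locales auto
qed

lemma hom_fixes_adjoin_rat:
  assumes "A \<subseteq> K" "\<And>a. a \<in> A \<Longrightarrow> \<sigma> a = a" "x \<in> adjoin_rat A"
  shows "\<sigma> x = x"
  using adjoin_rat_least[OF fixed_field, of A] assms by auto

lemma hom_maps_adjoin_rat:
  assumes "A \<subseteq> K" "\<And>a. a \<in> A \<Longrightarrow> \<sigma> a \<in> adjoin_rat A" "x \<in> adjoin_rat A"
  shows "\<sigma> x \<in> adjoin_rat A"
  using adjoin_rat_least[OF preimage_field[OF adjoin_rat_ops], of A A] assms by auto

lemma hom_Rats: "x \<in> \<rat> \<Longrightarrow> \<sigma> x = x"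
  using hom_fixes_adjoin_rat[of "{}" x] adjoin_rat_Rats by auto

lemma hom_rational_root:
  assumes "p \<in> polys \<rat>" "poly p x = 0" "x \<in> K"
  shows "poly p (\<sigma> x) = 0"
proof -
  have "map_poly \<sigma> p = p"
    by (rule poly_eqI) (simp add: hom_Rats polys_coeff[OF assms(1)])
  moreover have "p \<in> polys K"
    using polys_mono[OF _ assms(1)] adjoin_rat_Rats adjoin_rat_least[OF subfield_ops_axioms, of "{}"]
    by blast
  ultimately show ?thesis using hom_poly_eval[of p x] assms by simp
qed

lemma restrict_hom:
  assumes "subfield_ops S" "S \<subseteq> K"
  shows "field_embedding S \<sigma>"
proof -
  interpret S: subfield_ops S by fact
  show ?thesis by unfold_locales (use assms(2) in \<open>auto simp: subset_iff\<close>)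
qed

lemma funpow_hom:
  assumes "\<And>x. x \<in> K \<Longrightarrow> \<sigma> x \<in> K"
  shows "field_embedding K (\<sigma> ^^ n) \<and> (\<forall>x\<in>K. (\<sigma> ^^ n) x \<in> K)"
proof (induction n)
  case 0
  show ?case by (simp, unfold_locales) auto
next
  case (Suc n)
  then interpret s: field_embedding K "\<sigma> ^^ n" by blast
  show ?case using Suc assms by (intro conjI, unfold_locales) auto
qed

end


lemma identity_embedding: "subfield_ops K \<Longrightarrow> field_embedding K (\<lambda>x. x)"
  by (simp add: field_embedding_def field_embedding_axioms_def)

lemma Rats_subset_subfield: "subfield_ops (K :: 'a::field_char_0 set) \<Longrightarrow> \<rat> \<subseteq> K"
  using adjoin_rat_Rats[of "{}"] adjoin_rat_least[of K "{}"] by auto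

lemma algebraic_inverse_eq_poly:
  assumes "algebraic y"
  shows "\<exists>g\<in>polys \<rat>. inverse y = poly g y"
proof (cases "y = 0")
  case True
  then show ?thesis by (intro bexI[of _ 0]) auto
next
  case False
  obtain p where p: "poly (map_poly of_int p) y = 0" "p \<noteq> 0" "coeff p 0 \<noteq> 0"
    using algebraicE'_nonzero[OF assms False] by blast
  obtain c q where cq: "p = pCons c q" by (cases p)
  define g :: "'a poly" where "g = smult (- (1 / of_int c)) (map_poly of_int q)"
  have c: "(of_int c :: 'a) \<noteq> 0" using p(3) by (simp add: cq)
  have "of_int c + y * ipoly q y = 0" using p(1) by (simp add: cq map_poly_pCons)
  then have "y * ipoly q y = - of_int c" by (simp add: eq_neg_iff_add_eq_0 add.commute)
  then have "y * poly g y = 1" using c by (simp add: g_def)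
  then have "inverse y = poly g y" by (rule inverse_unique)
  moreover have "g \<in> polys \<rat>" unfolding g_def by simp
  ultimately show ?thesis by blast
qed

lemma simple_extension_algebraic:
  assumes "K \<subseteq> Collect algebraic" "algebraic \<theta>"
  shows "(\<lambda>p. poly p \<theta>) ` polys K \<subseteq> Collect algebraic"
proof safe
  fix p assume "p \<in> polys K"
  then show "algebraic (poly p \<theta>)"
    using assms(2) polys_mono[OF assms(1)] algebraics.poly_mem[of p \<theta>] by auto
qed

text \<open>Only inverses need an argument: the inverse of an algebraic number is a rational polynomial in it.\<close>
lemma simple_extension_ops:
  assumes K: "subfield_ops K" and alg: "K \<subseteq> Collect algebraic" and \<theta>: "algebraic \<theta>"
  shows "subfield_ops ((\<lambda>p. poly p \<theta>) ` polys K)"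
proof -
  interpret subfield_ops K by fact
  define L where "L = (\<lambda>p. poly p \<theta>) ` polys K"
  have LI: "poly p \<theta> \<in> L" if "p \<in> polys K" for p
    using that by (auto simp: L_def)
  have "subfield_ops L"
  proof
    fix x y assume "x \<in> L" "y \<in> L"
    then obtain p q where "p \<in> polys K" "x = poly p \<theta>" "q \<in> polys K" "y = poly q \<theta>"
      by (auto simp: L_def)
    then show "x + y \<in> L" "x * y \<in> L" "- x \<in> L"
      using LI[of "p + q"] LI[of "p * q"] LI[of "- p"] by auto
  next
    fix x assume x: "x \<in> L"
    then obtain p where p: "p \<in> polys K" "x = poly p \<theta>" by (auto simp: L_def)
    obtain g where g: "g \<in> polys \<rat>" "inverse x = poly g x"
      using algebraic_inverse_eq_poly[of x] x simple_extension_algebraic[OF alg \<theta>]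
      by (auto simp: L_def)
    have "g \<in> polys K"
      using g(1) polys_mono[OF Rats_subset_subfield[OF K]] by blast
    then have "poly (pcompose g p) \<theta> \<in> L" using p by (intro LI) simp
    then show "inverse x \<in> L" using g(2) p(2) by (simp add: poly_pcompose)
  qed (use LI[of 0] LI[of 1] in simp_all)
  then show ?thesis by (simp add: L_def)
qed

text \<open>Sending \<open>p(\<theta>)\<close> to \<open>(\<sigma>p)(\<theta>')\<close> is well defined, because two polynomials with the same value at
\<open>\<theta>\<close> differ by a multiple of the minimal polynomial.\<close>
lemma (in field_embedding) extend_simple:
  assumes alg: "K \<subseteq> Collect algebraic" and f: "is_minpoly K \<theta> f"
    and root: "poly (map_poly \<sigma> f) \<theta>' = 0"
  shows "\<exists>L \<tau>. field_embedding L \<tau> \<and> L \<subseteq> Collect algebraic \<and> K \<subseteq> L \<and> \<theta> \<in> L \<and>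
    (\<forall>x\<in>K. \<tau> x = \<sigma> x) \<and> \<tau> \<theta> = \<theta>'"
proof -
  define L where "L = (\<lambda>p. poly p \<theta>) ` polys K"
  define \<tau> where "\<tau> = (\<lambda>y. poly (map_poly \<sigma> (SOME p. p \<in> polys K \<and> poly p \<theta> = y)) \<theta>')"
  have f': "f \<in> polys K" "\<And>p. p \<in> polys K \<Longrightarrow> poly p \<theta> = 0 \<Longrightarrow> \<exists>q\<in>polys K. p = f * q"
      "poly f \<theta> = 0" "f \<noteq> 0"
    using is_minpolyD[OF f] by blast+
  have \<tau>: "\<tau> (poly p \<theta>) = poly (map_poly \<sigma> p) \<theta>'" if p: "p \<in> polys K" for p
  proof -
    define q where "q = (SOME q. q \<in> polys K \<and> poly q \<theta> = poly p \<theta>)"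
    have q: "q \<in> polys K" "poly q \<theta> = poly p \<theta>"
      using someI[of "\<lambda>q. q \<in> polys K \<and> poly q \<theta> = poly p \<theta>" p] p by (auto simp: q_def)
    then obtain r where r: "r \<in> polys K" "q - p = f * r"
      using f'(2)[of "q - p"] p by auto
    have "map_poly \<sigma> q - map_poly \<sigma> p = map_poly \<sigma> f * map_poly \<sigma> r"
      using hom_poly_diff[OF q(1) p] hom_poly_mult[OF f'(1) r(1)] r(2) by simp
    then have "poly (map_poly \<sigma> q) \<theta>' - poly (map_poly \<sigma> p) \<theta>' = 0"
      using root by (metis poly_diff poly_mult mult_zero_left)
    then show ?thesis by (simp add: \<tau>_def q_def)
  qed
  have "alg_over (Collect algebraic) \<theta>"
    using f'(1,3,4) polys_mono[OF alg] by (auto simp: alg_over_def)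
  then have \<theta>: "algebraic \<theta>" by (rule alg_over_algebraics)
  have L_alg: "L \<subseteq> Collect algebraic"
    unfolding L_def by (rule simple_extension_algebraic[OF alg \<theta>])
  interpret L: subfield_ops L
    unfolding L_def by (rule simple_extension_ops[OF subfield_ops_axioms alg \<theta>])
  have KL: "c \<in> L" if "c \<in> K" for c
    unfolding L_def using that by (intro image_eqI[of _ _ "[:c:]"]) simp_all
  have \<theta>L: "\<theta> \<in> L"
    unfolding L_def by (intro image_eqI[of _ _ "[:0, 1:]"]) simp_all
  have \<tau>K: "\<tau> c = \<sigma> c" if "c \<in> K" for c
    using \<tau>[of "[:c:]"] that by (simp add: map_poly_pCons)
  have "field_embedding L \<tau>"
  proof
    show "\<tau> 1 = 1" using \<tau>K[of 1] by simp
    fix x y assume "x \<in> L" "y \<in> L"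
    then obtain p q where pq: "p \<in> polys K" "x = poly p \<theta>" "q \<in> polys K" "y = poly q \<theta>"
      by (auto simp: L_def)
    show "\<tau> (x + y) = \<tau> x + \<tau> y"
      using \<tau>[of "p + q"] \<tau>[of p] \<tau>[of q] pq by (simp add: hom_poly_add)
    show "\<tau> (x * y) = \<tau> x * \<tau> y"
      using \<tau>[of "p * q"] \<tau>[of p] \<tau>[of q] pq by (simp add: hom_poly_mult)
  qed
  moreover have "\<tau> \<theta> = \<theta>'"
    using \<tau>[of "[:0, 1:]"] by (simp add: map_poly_pCons)
  ultimately show ?thesis using L_alg KL \<theta>L \<tau>K by blast
qed

lemma algebraic_imp_alg_over: "subfield_ops K \<Longrightarrow> algebraic x \<Longrightarrow> alg_over K x"
  using Rats_subset_subfield[of K] polys_mono[of \<rat> K]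
  by (auto simp: algebraic_iff_alg_over alg_over_def)

lemma extend_finite:
  fixes K :: "'a::{alg_closed_field, field_char_0} set"
  assumes "finite T" "T \<subseteq> Collect algebraic" "field_embedding K \<sigma>" "K \<subseteq> Collect algebraic"
  shows "\<exists>L \<tau>. field_embedding L \<tau> \<and> L \<subseteq> Collect algebraic \<and> K \<subseteq> L \<and> T \<subseteq> L \<and> (\<forall>x\<in>K. \<tau> x = \<sigma> x)"
  using assms(1,2)
proof (induction T rule: finite_induct)
  case empty
  show ?case using assms(3,4) by blast
next
  case (insert \<theta> T)
  then obtain L \<tau> where L: "field_embedding L \<tau>" "L \<subseteq> Collect algebraic" "K \<subseteq> L" "T \<subseteq> L"
      "\<forall>x\<in>K. \<tau> x = \<sigma> x" by auto
  interpret field_embedding L \<tau> by fact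
  obtain f where f: "is_minpoly L \<theta> f"
    using minpoly_exists algebraic_imp_alg_over[OF subfield_ops_axioms] insert.prems by blast
  have "degree f \<noteq> 0"
    using is_minpolyD[OF f] root_relation(1)[of f \<theta>] by auto
  moreover have "coeff (map_poly \<tau> f) (degree f) \<noteq> 0"
    using is_minpolyD[OF f] by simp
  ultimately have "degree (map_poly \<tau> f) > 0"
    by (metis coeff_eq_0 not_gr_zero)
  then obtain \<theta>' where "poly (map_poly \<tau> f) \<theta>' = 0" using alg_closed_imp_poly_has_root by blast
  from extend_simple[OF L(2) f this] obtain L' \<tau>' where
    "field_embedding L' \<tau>'" "L' \<subseteq> Collect algebraic" "L \<subseteq> L'" "\<theta> \<in> L'" "\<forall>x\<in>L. \<tau>' x = \<tau> x"
    by blast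
  with L show ?case by (intro exI[of _ L'] exI[of _ \<tau>']) auto
qed

text \<open>The minimal polynomial of an element outside \<open>K\<close> has a second root, because in
  characteristic 0 a double root would also be a root of the derivative.\<close>
lemma embedding_moving:
  fixes K :: "'a::{alg_closed_field, field_char_0} set"
  assumes K: "subfield_ops K" "K \<subseteq> Collect algebraic" and \<delta>: "algebraic \<delta>" "\<delta> \<notin> K"
  shows "\<exists>L \<tau>. field_embedding L \<tau> \<and> L \<subseteq> Collect algebraic \<and> K \<subseteq> L \<and> \<delta> \<in> L \<and>
    (\<forall>x\<in>K. \<tau> x = x) \<and> \<tau> \<delta> \<noteq> \<delta>"
proof -
  interpret subfield_ops K by fact
  have emb: "field_embedding K (\<lambda>x. x)" using K(1) by (rule identity_embedding)
  obtain f where f: "is_minpoly K \<delta> f"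
    using minpoly_exists algebraic_imp_alg_over[OF K(1) \<delta>(1)] by blast
  then have f': "f \<in> polys K" "lead_coeff f = 1" "poly f \<delta> = 0" "f \<noteq> 0"
      "\<And>p. p \<in> polys K \<Longrightarrow> poly p \<delta> = 0 \<Longrightarrow> f dvd p"
    using is_minpolyD[OF f] by blast+
  obtain g where g: "f = [:- \<delta>, 1:] * g"
    using f'(3)[unfolded poly_eq_0_iff_dvd] by (rule dvdE)
  have "degree g \<noteq> 0"
  proof
    assume "degree g = 0"
    then obtain c where c: "g = [:c:]" by (rule degree_eq_zeroE)
    have f_eq: "f = [:- \<delta> * c, c:]" using g c by simp
    then have "c \<noteq> 0" using f'(4) by auto
    then have "c = 1" using f'(2) unfolding f_eq by simp
    then have "f = [:- \<delta>, 1:]" using f_eq by simp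
    with f'(1) have "- \<delta> \<in> K" by simp
    then show False using \<delta>(2) uminus_mem[of "- \<delta>"] by simp
  qed
  then obtain \<delta>' where \<delta>': "poly g \<delta>' = 0" using alg_closed_imp_poly_has_root[of g] by auto
  have "\<delta>' \<noteq> \<delta>"
  proof
    assume "\<delta>' = \<delta>"
    with \<delta>' have "poly (pderiv f) \<delta> = 0" unfolding g pderiv_mult by simp
    then have dvd: "f dvd pderiv f" using f'(1) by (intro f'(5)) simp_all
    have "degree f \<noteq> 0" using root_relation(1)[OF f'(4,3)] by simp
    then have "pderiv f \<noteq> 0" by (simp add: pderiv_eq_0_iff)
    with dvd have "degree f \<le> degree (pderiv f)" by (rule dvd_imp_degree_le)
    with \<open>degree f \<noteq> 0\<close> show False by (simp add: degree_pderiv)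
  qed
  moreover have "poly (map_poly (\<lambda>x. x) f) \<delta>' = 0" using \<delta>' unfolding map_poly_id' g by simp
  ultimately show ?thesis using field_embedding.extend_simple[OF emb K(2) f] by blast
qed

section \<open>Normality and bounded exponent\<close>

text \<open>Every orbit of a permutation of at most \<open>k\<close> points has a length that divides \<open>k!\<close>.\<close>
lemma funpow_fact_fixes:
  assumes R: "finite R" "card R \<le> k" "inj_on \<sigma> R" "\<And>x. x \<in> R \<Longrightarrow> \<sigma> x \<in> R" and x: "x \<in> R"
  shows "(\<sigma> ^^ fact k) x = x"
proof -
  have mem: "(\<sigma> ^^ i) y \<in> R" if "y \<in> R" for i y
    using that R(4) by (induction i) auto
  have "\<not> inj_on (\<lambda>i. (\<sigma> ^^ i) x) {..k}"
  proof
    assume "inj_on (\<lambda>i. (\<sigma> ^^ i) x) {..k}"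
    then have "card {..k} \<le> card R" using mem[OF x] by (intro card_inj_on_le[OF _ _ R(1)]) auto
    with R(2) show False by simp
  qed
  then obtain i j where ij: "i < j" "j \<le> k" "(\<sigma> ^^ i) x = (\<sigma> ^^ j) x"
    unfolding inj_on_def by (metis atMost_iff linorder_neqE_nat)
  define d where "d = j - i"
  have cancel: "y = z" if "(\<sigma> ^^ i) y = (\<sigma> ^^ i) z" "y \<in> R" "z \<in> R" for y z i
    using that(1)
  proof (induction i)
    case (Suc i)
    then show ?case using inj_onD[OF R(3)] mem that by simp
  qed simp
  have "(\<sigma> ^^ i) ((\<sigma> ^^ d) x) = (\<sigma> ^^ i) x"
    using ij by (simp add: d_def funpow_add[symmetric, THEN fun_cong, simplified])
  then have d: "(\<sigma> ^^ d) x = x" using cancel mem x by blast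
  have "d dvd fact k" using ij by (intro dvd_fact) (auto simp: d_def)
  then obtain m where "fact k = d * m" by blast
  moreover have "((\<sigma> ^^ d) ^^ m) x = x" using d by (induction m) auto
  ultimately show ?thesis by (simp add: funpow_mult)
qed

text \<open>Every \<open>x\<close> in \<^term>\<open>bounded_degree_field k\<close> lies in a field \<open>S\<close> that is generated by the full root
sets of finitely many rational polynomials of degree at most \<open>k\<close>. An embedding permutes each root
set, so it maps \<open>S\<close> to itself, and its \<open>k!\<close>-th iterate is the identity on \<open>S\<close>.\<close>
lemma bounded_degree_field_normal:
  fixes K :: "'a::{alg_closed_field, field_char_0} set"
  assumes x: "x \<in> bounded_degree_field k" and K: "field_embedding K \<sigma>" "K \<subseteq> Collect algebraic"
  shows "\<exists>L \<tau> S. field_embedding L \<tau> \<and> K \<subseteq> L \<and> (\<forall>y\<in>K. \<tau> y = \<sigma> y) \<and>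
    subfield_ops S \<and> x \<in> S \<and> S \<subseteq> L \<and> S \<subseteq> bounded_degree_field k \<and>
    (\<forall>y\<in>S. \<tau> y \<in> S) \<and> (\<forall>y\<in>S. (\<tau> ^^ fact k) y = y)"
proof -
  obtain B where B: "finite B" "\<And>b. b \<in> B \<Longrightarrow> alg_deg_le k b" "x \<in> adjoin_rat B"
    using adjoin_rat_finite_support[OF x[unfolded bounded_degree_field_eq]] by auto
  then have "\<forall>b\<in>B. \<exists>p\<in>polys \<rat>. p \<noteq> 0 \<and> degree p \<le> k \<and> poly p b = 0"
    by (simp add: alg_deg_le_def)
  then obtain p where p: "\<And>b. b \<in> B \<Longrightarrow> p b \<in> polys \<rat> \<and> p b \<noteq> 0 \<and> degree (p b) \<le> k \<and> poly (p b) b = 0"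
    by metis
  define R where "R = (\<lambda>b. {y. poly (p b) y = 0})"
  define A where "A = (\<Union>b\<in>B. R b)"
  have R: "finite (R b)" "card (R b) \<le> k" if "b \<in> B" for b
    using p[OF that] poly_roots_finite[of "p b"] card_poly_roots_bound[of "p b"] by (auto simp: R_def)
  have A: "alg_deg_le k a" if "a \<in> A" for a
    using that p by (auto simp: A_def R_def alg_deg_le_def)
  have BA: "B \<subseteq> A" using p by (auto simp: A_def R_def)
  have "finite A" using B(1) R by (auto simp: A_def)
  then obtain L \<tau> where L: "field_embedding L \<tau>" "K \<subseteq> L" "A \<subseteq> L" "\<forall>y\<in>K. \<tau> y = \<sigma> y"
    using extend_finite[OF _ _ K, of A] A alg_deg_le_algebraic by blast
  interpret field_embedding L \<tau> by fact
  define S where "S = adjoin_rat A"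
  have S: "S \<subseteq> L" unfolding S_def by (intro adjoin_rat_least subfield_ops_axioms L)
  have \<tau>R: "\<tau> y \<in> R b" if "y \<in> R b" "b \<in> B" for y b
  proof -
    have "y \<in> L" using that L(3) by (auto simp: A_def)
    then show ?thesis using hom_rational_root[of "p b" y] p[OF that(2)] that(1) by (simp add: R_def)
  qed
  have \<tau>S: "\<tau> y \<in> S" if "y \<in> S" for y
    using hom_maps_adjoin_rat[OF L(3) _ that[unfolded S_def]] \<tau>R adjoin_rat_incl[of A]
    unfolding S_def A_def by blast
  interpret S: field_embedding S \<tau> by (rule restrict_hom[OF _ S]) (simp add: S_def adjoin_rat_ops)
  interpret F: field_embedding S "\<tau> ^^ fact k" using S.funpow_hom[OF \<tau>S] by blast
  have "(\<tau> ^^ fact k) y = y" if "y \<in> S" for y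
  proof (rule F.hom_fixes_adjoin_rat)
    show "A \<subseteq> S" using adjoin_rat_incl by (simp add: S_def)
    fix a assume "a \<in> A"
    then obtain b where b: "b \<in> B" "a \<in> R b" by (auto simp: A_def)
    have "R b \<subseteq> L" using b L(3) by (auto simp: A_def)
    then show "(\<tau> ^^ fact k) a = a"
      using b R \<tau>R by (intro funpow_fact_fixes[of "R b"] inj_on_subset[OF hom_inj]) auto
  qed (use that S_def in simp)
  moreover have "x \<in> S" using B(3) adjoin_rat_mono[OF BA] by (auto simp: S_def)
  moreover have "S \<subseteq> bounded_degree_field k"
    unfolding S_def bounded_degree_field_eq using A by (intro adjoin_rat_mono) auto
  ultimately show ?thesis using L S \<tau>S S.subfield_ops_axioms by blast
qed

section \<open>Primitive integer polynomials\<close>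

lemma ipoly_simps [simp]:
  "ipoly (p + q) x = ipoly p x + ipoly q x"
  "ipoly (p - q) x = ipoly p x - ipoly q x"
  "ipoly (p * q) x = ipoly p x * ipoly q x"
  "ipoly (smult c p) x = of_int c * ipoly p x"
  "ipoly (monom c n) x = of_int c * x ^ n"
  "ipoly (p ^ n) x = ipoly p x ^ n"
proof -
  have add: "map_poly of_int (p + q) = map_poly of_int p + (map_poly of_int q :: 'a poly)"
    by (rule poly_eqI) (simp add: coeff_map_poly)
  have diff: "map_poly of_int (p - q) = map_poly of_int p - (map_poly of_int q :: 'a poly)"
    by (rule poly_eqI) (simp add: coeff_map_poly)
  have mult: "map_poly of_int (p * q) = map_poly of_int p * (map_poly of_int q :: 'a poly)" for p q
    by (rule poly_eqI) (simp add: coeff_map_poly coeff_mult)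
  have smult: "map_poly of_int (smult c p) = smult (of_int c) (map_poly of_int p :: 'a poly)"
    by (rule poly_eqI) (simp add: coeff_map_poly)
  have monom: "map_poly of_int (monom c n) = monom (of_int c :: 'a) n"
    by (rule poly_eqI) (simp add: coeff_map_poly)
  have one: "map_poly of_int 1 = (1 :: 'a poly)" by simp
  have power: "map_poly of_int (p ^ n) = (map_poly of_int p :: 'a poly) ^ n"
    by (induction n) (simp_all add: mult one)
  show "ipoly (p + q) x = ipoly p x + ipoly q x" "ipoly (p - q) x = ipoly p x - ipoly q x"
    "ipoly (p * q) x = ipoly p x * ipoly q x" "ipoly (smult c p) x = of_int c * ipoly p x"
    "ipoly (monom c n) x = of_int c * x ^ n" "ipoly (p ^ n) x = ipoly p x ^ n"
    by (simp_all add: add diff mult smult monom power poly_monom poly_power)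
qed

lemma ipoly_pCons [simp]: "ipoly (pCons c p) x = of_int c + x * ipoly p x"
  by (cases "pCons c p = 0") (auto simp: map_poly_pCons)

lemma ipoly_sum [simp]: "ipoly (\<Sum>i\<in>I. f i) x = (\<Sum>i\<in>I. ipoly (f i) x)"
  by (induction I rule: infinite_finite_induct) simp_all

lemma ipoly_pcompose_monom: "ipoly (pcompose p (monom 1 n)) x = ipoly p (x ^ n)"
  by (induction p) (simp_all add: pcompose_pCons)

lemma clear_denominators:
  fixes p :: "'a::field_char_0 poly"
  assumes "p \<in> polys \<rat>"
  shows "\<exists>d::int. d \<noteq> 0 \<and> (\<exists>P. smult (of_int d) p = map_poly of_int P)"
  using assms
proof (induction p)
  case 0
  show ?case by (intro exI[of _ 1] conjI exI[of _ 0]) simp_all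
next
  case (pCons a p)
  then obtain d :: int and P where d: "d \<noteq> 0" "smult (of_int d) p = map_poly of_int P" by auto
  have "a \<in> \<rat>" using pCons.prems by simp
  then obtain u v :: int where "v > 0" "coprime u v" and a: "a = of_int u / of_int v"
    by (rule Rats_cases')
  then have uv: "v \<noteq> 0" "a = of_int u / of_int v" by simp_all
  have "smult (of_int (v * d)) (pCons a p) = map_poly of_int (pCons (u * d) (smult v P))"
  proof (rule poly_eqI)
    fix i
    have "of_int d * coeff p j = of_int (coeff P j)" for j
      using d(2) by (metis coeff_map_poly coeff_smult of_int_0)
    then show "coeff (smult (of_int (v * d)) (pCons a p)) i =
        coeff (map_poly of_int (pCons (u * d) (smult v P)) :: 'a poly) i"
      using uv by (cases i) (simp_all add: coeff_map_poly mult.assoc)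
  qed
  with uv d show ?case by (intro exI[of _ "v * d"]) auto
qed

lemma degree_of_int_poly [simp]: "degree (map_poly of_int p :: 'a::field_char_0 poly) = degree p"
  by (rule degree_map_poly) simp

lemma of_int_poly_eq_0_iff [simp]: "map_poly of_int p = (0 :: 'a::field_char_0 poly) \<longleftrightarrow> p = 0"
  by (simp add: map_poly_eq_0_iff)

text \<open>By Gauss's lemma, a primitive integer polynomial of least degree with root \<open>x\<close> divides over
  the integers all other ones.\<close>
lemma primitive_minpoly_exists:
  fixes x :: "'a::field_char_0"
  assumes "alg_deg_le n x"
  obtains p :: "int poly" where "p \<noteq> 0" "content p = 1" "degree p \<le> n" "ipoly p x = 0"
    "\<And>G. ipoly G x = 0 \<Longrightarrow> p dvd G"
proof -
  define Q where "Q = (\<lambda>p::int poly. p \<noteq> 0 \<and> ipoly p x = 0)"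
  have "\<exists>p. Q p \<and> degree p \<le> n"
  proof -
    obtain q where q: "q \<in> polys \<rat>" "q \<noteq> 0" "degree q \<le> n" "poly q x = 0"
      using assms by (auto simp: alg_deg_le_def)
    obtain d :: int and P where d: "d \<noteq> 0" "smult (of_int d) q = map_poly of_int P"
      using clear_denominators[OF q(1)] by auto
    have "ipoly P x = 0" using d(2)[symmetric] q(4) by simp
    moreover have "P \<noteq> 0" using d q(2) by (metis map_poly_0 of_int_eq_0_iff smult_eq_0_iff)
    moreover have "degree P = degree q"
      using d by (metis degree_of_int_poly degree_smult_eq of_int_eq_0_iff)
    ultimately show ?thesis using q(3) by (intro exI[of _ P]) (simp add: Q_def)
  qed
  then obtain p0 where p0: "Q p0" "degree p0 \<le> n" by blast
  obtain g where g: "Q g" and min: "\<And>p. Q p \<Longrightarrow> degree g \<le> degree p"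
    using ex_has_least_nat[of Q p0 degree] p0 by blast
  define p where "p = primitive_part g"
  have g_eq: "g = smult (content g) p" by (simp add: p_def)
  have g0: "g \<noteq> 0" "ipoly g x = 0" using g by (auto simp: Q_def)
  have p: "p \<noteq> 0" "content p = 1" "degree p = degree g"
    using g0 by (auto simp: p_def)
  have "of_int (content g) * ipoly p x = 0"
    using g0(2) unfolding ipoly_simps(4)[symmetric] g_eq[symmetric] .
  then have root: "ipoly p x = 0" using g0(1) by simp
  have dvd: "p dvd G" if G: "ipoly G x = 0" for G
  proof -
    obtain q r where qr: "pseudo_divmod G p = (q, r)" by (cases "pseudo_divmod G p")
    define c where "c = lead_coeff p ^ (Suc (degree G) - degree p)"
    have eq: "smult c G = p * q + r" and deg: "r = 0 \<or> degree r < degree p"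
      using pseudo_divmod[OF p(1) qr] by (auto simp: c_def)
    have "ipoly r x = 0"
      using arg_cong[OF eq, of "\<lambda>p. ipoly p x"] G root by simp
    then have "r = 0" using deg min[of r] p(3) unfolding Q_def by (metis leD)
    with eq have eq: "smult c G = p * q" by simp
    have c: "c \<noteq> 0" using p(1) by (simp add: c_def)
    have "normalize c * content G = content q"
      using arg_cong[OF eq, of content] p(2) by (simp add: content_mult)
    then have "c dvd content q" by (metis dvd_triv_left normalize_dvd_iff)
    then have "[:c:] dvd q" by (simp add: const_poly_dvd_iff_dvd_content)
    then obtain h where "q = [:c:] * h" by (rule dvdE)
    with eq have "smult c G = smult c (p * h)" by simp
    with c have "G = p * h" by (metis smult_cancel)
    then show ?thesis by simp
  qed
  have "degree p \<le> n" using min[OF p0(1)] p0(2) p(3) by simp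
  from that[OF p(1,2) this root dvd] show ?thesis .
qed

section \<open>Roots of bounded degree of a fixed number\<close>

text \<open>Split off one linear factor at a time: multiplication by \<open>x - z\<close> with \<open>|z| \<le> C\<close> increases the
largest coefficient by a factor of at most \<open>1 + C\<close>.\<close>
lemma coeff_bound_of_roots:
  fixes q :: "complex poly"
  assumes "C \<ge> 0" "\<And>z. poly q z = 0 \<Longrightarrow> q \<noteq> 0 \<Longrightarrow> norm z \<le> C"
  shows "norm (coeff q i) \<le> norm (lead_coeff q) * (1 + C) ^ degree q"
  using assms(2)
proof (induction "degree q" arbitrary: q i)
  case 0
  then obtain c where "q = [:c:]" by (metis degree_eq_zeroE)
  then show ?case by (cases i) simp_all
next
  case (Suc d)
  then have q0: "q \<noteq> 0" by auto
  obtain z where z: "poly q z = 0" using alg_closed_imp_poly_has_root[of q] Suc.hyps(2) by auto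
  then obtain r where r: "q = [:- z, 1:] * r" by (auto simp only: poly_eq_0_iff_dvd elim: dvdE)
  have r0: "r \<noteq> 0" using q0 r by auto
  have deg: "degree q = Suc (degree r)" unfolding r by (subst degree_mult_eq) (use r0 in simp_all)
  have lc: "lead_coeff q = lead_coeff r" unfolding r lead_coeff_mult by simp
  define B where "B = norm (lead_coeff r) * (1 + C) ^ degree r"
  have IH: "norm (coeff r i) \<le> B" for i
    unfolding B_def
  proof (rule Suc.hyps(1))
    show "d = degree r" using deg Suc.hyps(2) by simp
    show "norm w \<le> C" if "poly r w = 0" for w
      using Suc.prems[of w] that q0 unfolding r by simp
  qed
  have zC: "norm z \<le> C" using Suc.prems z q0 by blast
  have B0: "B \<ge> 0" using assms(1) by (simp add: B_def)
  have "coeff q i = (case i of 0 \<Rightarrow> 0 | Suc j \<Rightarrow> coeff r j) - z * coeff r i"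
    unfolding r by (cases i) simp_all
  also have "norm \<dots> \<le> B + C * B"
  proof (rule order_trans[OF norm_triangle_ineq4] add_mono)+
    show "norm (case i of 0 \<Rightarrow> 0 | Suc j \<Rightarrow> coeff r j) \<le> B"
      using IH B0 by (cases i) simp_all
    show "norm (z * coeff r i) \<le> C * B"
      unfolding norm_mult using zC IH assms(1) by (intro mult_mono) simp_all
  qed
  also have "\<dots> = norm (lead_coeff q) * (1 + C) ^ degree q"
    unfolding B_def lc unfolding deg by (simp add: algebra_simps)
  finally show ?case .
qed

lemma finite_polys_bounded:
  assumes "finite (A :: 'a::zero set)"
  shows "finite {p. degree p \<le> n \<and> (\<forall>i. coeff p i \<in> A)}"
proof (rule finite_subset)
  show "{p. degree p \<le> n \<and> (\<forall>i. coeff p i \<in> A)} \<subseteq> Poly ` {xs. set xs \<subseteq> A \<and> length xs \<le> Suc n}"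
  proof
    fix p assume p: "p \<in> {p. degree p \<le> n \<and> (\<forall>i. coeff p i \<in> A)}"
    have "length (coeffs p) \<le> Suc n" using p by (cases "p = 0") (auto simp: length_coeffs_degree)
    moreover have "set (coeffs p) \<subseteq> A" using p by (auto simp: coeffs_def)
    ultimately show "p \<in> Poly ` {xs. set xs \<subseteq> A \<and> length xs \<le> Suc n}"
      by (intro image_eqI[of _ _ "coeffs p"]) simp_all
  qed
qed (intro finite_imageI finite_lists_length_le assms)

text \<open>Northcott's argument. Let \<open>F\<close> be an integer polynomial with root \<open>\<alpha>\<close>. The primitive minimal
polynomial \<open>p\<close> of \<open>\<gamma>\<close> divides \<open>F(x\<^sup>e)\<close>, which has the leading coefficient of \<open>F\<close> and whose complex
roots are no larger than the maximum of 1 and the roots of \<open>F\<close>. Both the leading coefficient and the roots of \<open>p\<close>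
are thus bounded independently of \<open>e\<close>, which leaves finitely many \<open>p\<close>.\<close>
theorem finite_bounded_degree_radicals:
  fixes \<alpha> :: "'a::field_char_0"
  assumes "algebraic \<alpha>"
  shows "finite {\<gamma>. alg_deg_le n \<gamma> \<and> (\<exists>e\<ge>1. \<gamma> ^ e = \<alpha>)}"
proof -
  obtain F :: "int poly" where F: "F \<noteq> 0" "ipoly F \<alpha> = 0"
    using assms by (elim algebraicE')
  define l where "l = lead_coeff F"
  define FC where "FC = (map_poly of_int F :: complex poly)"
  have FC: "FC \<noteq> 0" using F(1) by (simp add: FC_def)
  define C where "C = Max (insert 1 (norm ` {z. poly FC z = 0}))"
  have fin: "finite (insert 1 (norm ` {z. poly FC z = 0}))"
    using poly_roots_finite[OF FC] by simp
  have C: "norm z \<le> C" if "poly FC z = 0" for z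
    unfolding C_def by (rule Max_ge[OF fin]) (use that in auto)
  have C1: "C \<ge> 1" unfolding C_def by (rule Max_ge[OF fin]) auto
  define B where "B = \<lceil>\<bar>real_of_int l\<bar> * (1 + C) ^ n\<rceil>"
  define P where "P = {p::int poly. degree p \<le> n \<and> (\<forall>i. coeff p i \<in> {-B..B})}"
  have "finite P" unfolding P_def by (rule finite_polys_bounded) simp
  have "{\<gamma>. alg_deg_le n \<gamma> \<and> (\<exists>e\<ge>1. \<gamma> ^ e = \<alpha>)} \<subseteq> (\<Union>p\<in>P - {0}. {\<gamma>. ipoly p \<gamma> = 0})"
  proof
    fix \<gamma> assume "\<gamma> \<in> {\<gamma>. alg_deg_le n \<gamma> \<and> (\<exists>e\<ge>1. \<gamma> ^ e = \<alpha>)}"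
    then obtain e where \<gamma>: "alg_deg_le n \<gamma>" and e: "e \<ge> 1" "\<gamma> ^ e = \<alpha>" by auto
    obtain p where p: "p \<noteq> 0" "degree p \<le> n" "ipoly p \<gamma> = 0" and dvd: "\<And>G. ipoly G \<gamma> = 0 \<Longrightarrow> p dvd G"
      using primitive_minpoly_exists[OF \<gamma>] by blast
    define G where "G = pcompose F (monom 1 e)"
    have "p dvd G"
      by (rule dvd) (simp add: G_def ipoly_pcompose_monom e F)
    then obtain h where h: "G = p * h" by (rule dvdE)
    have "lead_coeff G = l"
      unfolding G_def l_def using e by (subst lead_coeff_comp) (simp_all add: degree_monom_eq)
    then have "l = lead_coeff p * lead_coeff h" unfolding h lead_coeff_mult by simp
    then have "lead_coeff p dvd l" by simp
    then have lc: "\<bar>lead_coeff p\<bar> \<le> \<bar>l\<bar>" using F(1) by (intro dvd_imp_le_int) (simp_all add: l_def)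
    have coeff: "\<bar>coeff p i\<bar> \<le> B" for i
    proof -
      define pC where "pC = (map_poly of_int p :: complex poly)"
      have "norm z \<le> C" if "poly pC z = 0" for z
      proof -
        have "ipoly G z = 0" using that by (simp add: h pC_def)
        then have "poly FC (z ^ e) = 0" by (simp add: G_def FC_def ipoly_pcompose_monom)
        from C[OF this] have "norm z ^ e \<le> C" by (simp add: norm_power)
        moreover have "norm z \<le> norm z ^ e" if "norm z > 1"
          using self_le_power[of "norm z" e] that e by simp
        ultimately show ?thesis using C1 by force
      qed
      then have "norm (coeff pC i) \<le> norm (lead_coeff pC) * (1 + C) ^ degree pC"
        using C1 by (intro coeff_bound_of_roots) auto
      then have "\<bar>real_of_int (coeff p i)\<bar> \<le> \<bar>real_of_int (lead_coeff p)\<bar> * (1 + C) ^ degree p"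
        by (simp add: pC_def coeff_map_poly)
      also have "\<dots> \<le> \<bar>real_of_int l\<bar> * (1 + C) ^ n"
        using lc p(2) C1 by (intro mult_mono power_increasing) (auto simp flip: of_int_abs)
      finally show ?thesis unfolding B_def by linarith
    qed
    then have "p \<in> P" using p(2) by (simp add: P_def abs_le_iff) (metis minus_le_iff)
    with p show "\<gamma> \<in> (\<Union>p\<in>P - {0}. {\<gamma>. ipoly p \<gamma> = 0})" by auto
  qed
  moreover have "finite (\<Union>p\<in>P - {0}. {\<gamma>::'a. ipoly p \<gamma> = 0})"
  proof (rule finite_UN_I)
    show "finite {\<gamma>::'a. ipoly p \<gamma> = 0}" if "p \<in> P - {0}" for p
      using that by (intro poly_roots_finite) simp
  qed (use \<open>finite P\<close> in simp)
  ultimately show ?thesis by (rule finite_subset)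
qed

text \<open>If \<open>\<gamma>\<^sup>e = \<alpha> = \<gamma>\<^bsup>e'\<^esup>\<close> for two exponents, then \<open>\<gamma>\<close> and with it \<open>\<alpha>\<close> is a root of unity. So distinct
exponents need distinct \<open>\<gamma>\<close>.\<close>
corollary bounded_degree_exponents:
  fixes \<alpha> :: "'a::field_char_0"
  assumes "algebraic \<alpha>" "\<alpha> \<noteq> 0" "\<not> root_of_unity \<alpha>"
  shows "finite {e. e \<ge> 1 \<and> (\<exists>\<gamma>. alg_deg_le n \<gamma> \<and> \<gamma> ^ e = \<alpha>)}" (is "finite ?E")
proof -
  define \<gamma> where "\<gamma> = (\<lambda>e. SOME \<gamma>. alg_deg_le n \<gamma> \<and> \<gamma> ^ e = \<alpha>)"
  have \<gamma>: "alg_deg_le n (\<gamma> e)" "\<gamma> e ^ e = \<alpha>" if "e \<in> ?E" for e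
    using someI_ex[of "\<lambda>\<gamma>. alg_deg_le n \<gamma> \<and> \<gamma> ^ e = \<alpha>"] that by (auto simp: \<gamma>_def)
  have ne: "\<gamma> e \<noteq> \<gamma> e'" if "e \<in> ?E" "e' \<in> ?E" "e < e'" for e e'
  proof
    assume eq: "\<gamma> e = \<gamma> e'"
    have "\<gamma> e ^ (e' - e) * \<gamma> e ^ e = \<gamma> e ^ e'"
      using that by (simp add: power_add[symmetric])
    then have "\<gamma> e ^ (e' - e) * \<alpha> = \<alpha>"
      using \<gamma>(2)[OF that(2)] unfolding eq[symmetric] \<gamma>(2)[OF that(1)] by simp
    then have "\<gamma> e ^ (e' - e) = 1" using assms(2) by simp
    then have "\<alpha> ^ (e' - e) = 1"
      using \<gamma>(2)[OF that(1)] by (metis power_commutes power_mult mult.commute power_one)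
    then show False using assms(3) that by (auto simp: root_of_unity_def)
  qed
  have "inj_on \<gamma> ?E"
    by (rule inj_onI) (metis (no_types, lifting) ne linorder_neqE_nat)
  moreover have "finite (\<gamma> ` ?E)"
    by (rule finite_subset[OF _ finite_bounded_degree_radicals[OF assms(1), of n]]) (use \<gamma> in auto)
  ultimately show ?thesis by (rule finite_imageD[rotated])
qed

section \<open>Roots of unity in fields generated by bounded degree\<close>

lemma prime_dvd_power_add_diff:
  fixes f g :: "int poly"
  assumes l: "Factorial_Ring.prime (l :: nat)"
  shows "[:int l:] dvd (f + g) ^ l - (f ^ l + g ^ l)"
proof -
  have l1: "l > 1" using prime_gt_1_nat[OF l] .
  define t where "t = (\<lambda>k. of_nat (l choose k) * f ^ k * g ^ (l - k))"
  have "(f + g) ^ l = (\<Sum>k\<le>l. t k)"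
    unfolding t_def by (rule binomial_ring)
  also have "{..l} = insert 0 (insert l {0<..<l})" using l1 by auto
  also have "sum t \<dots> = t 0 + (t l + sum t {0<..<l})"
    using l1 by simp
  finally have "(f + g) ^ l = t 0 + (t l + sum t {0<..<l})" .
  moreover have "t 0 = g ^ l" "t l = f ^ l" by (simp_all add: t_def)
  ultimately have "(f + g) ^ l - (f ^ l + g ^ l) = sum t {0<..<l}" by simp
  also have "[:int l:] dvd \<dots>"
  proof (rule dvd_sum)
    fix k assume "k \<in> {0<..<l}"
    then have "l dvd (l choose k)" using l by (intro dvd_choose_prime) auto
    then have "[:int l:] dvd of_nat (l choose k)" by (simp add: of_nat_poly)
    then show "[:int l:] dvd t k" unfolding t_def mult.assoc by (rule dvd_mult2)
  qed
  finally show ?thesis .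
qed

lemma prime_power_dvd_frobenius:
  assumes l: "Factorial_Ring.prime (l :: nat)"
  shows "[:int l:] dvd [:-1, 1:] ^ (l ^ a) - (monom 1 (l ^ a) - 1)"
proof (induction a)
  case 0
  have "[:-1, 1:] - (monom 1 1 - 1) = (0 :: int poly)" by (simp add: monom_altdef one_pCons)
  then show ?case by simp
next
  case (Suc a)
  define D where "D = ([:-1, 1:] :: int poly) ^ (l ^ a)"
  define m where "m = (monom 1 (l ^ a) :: int poly)"
  have "D - (m - 1) dvd D ^ l - (m - 1) ^ l"
    by (subst power_diff_sumr2) simp
  with Suc have 1: "[:int l:] dvd D ^ l - (m - 1) ^ l"
    unfolding D_def m_def by (rule dvd_trans)
  have 2: "[:int l:] dvd (m - 1) ^ l - (m ^ l + (- 1) ^ l)"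
    using prime_dvd_power_add_diff[OF l, of m "- 1"] by simp
  have 3: "[:int l:] dvd (- 1) ^ l - (- 1)"
  proof (cases "l = 2")
    case True
    then show ?thesis by (simp add: numeral_poly)
  next
    case False
    then have "odd l" using l prime_odd_nat[of l] prime_ge_2_nat[OF l] by simp
    then show ?thesis by simp
  qed
  have "D ^ l - (m ^ l - 1) = (D ^ l - (m - 1) ^ l) + ((m - 1) ^ l - (m ^ l + (- 1) ^ l)) + ((- 1) ^ l - (- 1))"
    by simp
  also have "[:int l:] dvd \<dots>" by (intro dvd_add 1 2 3)
  finally show ?case
    by (simp add: D_def m_def power_mult[symmetric] monom_power mult.commute)
qed

text \<open>Modulo \<open>l\<close> the power \<open>(x - 1)\<^bsup>l^a\<^esup>\<close> is \<open>x\<^bsup>l^a\<^esup> - 1\<close>. Hence a value \<open>r(1) = r(1) - r(\<xi>)\<close>,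
  being a multiple of \<open>1 - \<xi>\<close>, cannot be a unit: otherwise \<open>1/l\<close> would be an integral
  combination of powers of \<open>\<xi>\<close>.\<close>
lemma prime_power_root_value_at_one:
  fixes \<xi> :: "'a::field_char_0" and r :: "int poly"
  assumes l: "Factorial_Ring.prime (l :: nat)" and \<xi>: "\<xi> ^ (l ^ a) = 1" and r: "ipoly r \<xi> = 0"
  shows "\<bar>poly r 1\<bar> \<noteq> 1"
proof
  assume unit: "\<bar>poly r 1\<bar> = 1"
  define q where "q = l ^ a"
  have q: "q \<ge> 1" using prime_gt_0_nat[OF l] by (simp add: q_def Suc_le_eq)
  have "[:-1, 1:] dvd r - [:poly r 1:]" by (simp add: poly_eq_0_iff_dvd[symmetric])
  then obtain s where "r - [:poly r 1:] = [:-1, 1:] * s" by (rule dvdE)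
  then have "ipoly (r - [:poly r 1:]) \<xi> = ipoly ([:-1, 1:] * s) \<xi>" by simp
  then have rs: "- of_int (poly r 1) = (\<xi> - 1) * ipoly s \<xi>"
    using r by (simp add: left_diff_distrib)
  obtain G where G: "[:-1, 1:] ^ q - (monom 1 q - 1) = [:int l:] * G"
    using prime_power_dvd_frobenius[OF l, of a] by (auto simp: q_def elim: dvdE)
  have "ipoly ([:-1, 1:] ^ q - (monom 1 q - 1)) \<xi> = ipoly ([:int l:] * G) \<xi>" by (simp only: G)
  then have "(\<xi> - 1) ^ q = of_nat l * ipoly G \<xi>" using \<xi> by (simp add: q_def)
  then have "(- of_int (poly r 1)) ^ q = of_nat l * (ipoly G \<xi> * ipoly s \<xi> ^ q)"
    by (simp add: rs power_mult_distrib)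
  then have "((- of_int (poly r 1)) ^ q) ^ 2 = (of_nat l * (ipoly G \<xi> * ipoly s \<xi> ^ q)) ^ 2" by simp
  moreover have "((- of_int (poly r 1)) ^ q) ^ 2 = (1 :: 'a)"
    using unit by (auto simp: abs_if power_mult[symmetric] mult.commute split: if_splits)
  ultimately have one: "of_nat l * ipoly (smult (int l) ((G * s ^ q) ^ 2)) \<xi> = 1"
    by (simp add: power2_eq_square ac_simps)
  define H where "H = smult (int l) ((G * s ^ q) ^ 2)"
  have "algebraic \<xi>"
    by (rule algebraic_root[of 1 "monom 1 q"]) (use prime_gt_0_nat[OF l] \<xi> in \<open>auto simp: poly_monom q_def degree_monom_eq\<close>)
  then obtain n where "alg_deg_le n \<xi>" by (auto simp: algebraic_iff_alg_deg_le)
  then obtain p where p: "p \<noteq> 0" "ipoly p \<xi> = 0" and dvd: "\<And>G. ipoly G \<xi> = 0 \<Longrightarrow> p dvd G"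
    using primitive_minpoly_exists by blast
  have "p dvd monom 1 q - 1" by (rule dvd) (use \<xi> in \<open>simp add: q_def\<close>)
  then obtain h where h: "monom 1 q - 1 = p * h" by (rule dvdE)
  have "lead_coeff (monom 1 q - 1 :: int poly) = 1"
  proof -
    have "degree (monom 1 q - 1 :: int poly) = q"
      using q degree_add_eq_left[of "- 1" "monom 1 q :: int poly"] by (simp add: degree_monom_eq)
    then show ?thesis using q by simp
  qed
  then have "lead_coeff p * lead_coeff h = 1" by (metis h lead_coeff_mult)
  then have lc: "\<bar>lead_coeff p\<bar> = 1" by (auto simp: zmult_eq_1_iff)
  \<comment> \<open>since \<open>p\<close> has leading coefficient \<open>1\<close> or \<open>-1\<close>, the inverse of \<open>l\<close> can be reduced modulo \<open>p\<close>;
    the degree of the result is too small for a multiple of \<open>p\<close>\<close>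
  obtain Q R where QR: "pseudo_divmod H p = (Q, R)" by (cases "pseudo_divmod H p")
  define u where "u = lead_coeff p ^ (Suc (degree H) - degree p)"
  have eq: "smult u H = p * Q + R" and deg: "R = 0 \<or> degree R < degree p"
    using pseudo_divmod[OF p(1) QR] by (auto simp: u_def)
  have u: "\<bar>u\<bar> = 1" using lc by (simp add: u_def power_abs)
  have "ipoly R \<xi> = of_int u * ipoly H \<xi>"
    using arg_cong[OF eq, of "\<lambda>p. ipoly p \<xi>"] p(2) by simp
  then have "ipoly (smult (int l) R - [:u:]) \<xi> = of_int u * (of_nat l * ipoly H \<xi>) - of_int u"
    by simp
  also have "\<dots> = 0" using one unfolding H_def by simp
  finally have "p dvd smult (int l) R - [:u:]" by (rule dvd)
  moreover have "degree (smult (int l) R - [:u:]) < degree p"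
  proof -
    have "degree p \<noteq> 0"
      using root_relation(1)[of "map_poly of_int p" \<xi>] p by auto
    then show ?thesis using deg by (intro degree_diff_less) (auto intro: le_less_trans[OF degree_smult_le])
  qed
  ultimately have "smult (int l) R - [:u:] = 0"
    using dvd_imp_degree_le[of p "smult (int l) R - [:u:]"] leD by blast
  then have "smult (int l) R = [:u:]" by simp
  then have "int l * coeff R 0 = u" by (metis coeff_pCons_0 coeff_smult)
  then have "int l dvd u" by (metis dvd_triv_left)
  then have "int l dvd 1" using u by (metis abs_dvd_iff dvd_abs_iff)
  then show False using l by (simp add: prime_nat_iff)
qed

text \<open>The cyclotomic polynomial \<open>\<Psi>\<close> of order \<open>l\<^sup>a\<close> takes the prime value \<open>l\<close> at 1. If it were a product
\<open>p h\<close> with \<open>p(\<zeta>) = 0\<close> and \<open>h(\<zeta>\<^sup>u) = 0\<close>, then \<open>p(1)\<close> or \<open>h(1)\<close> would be a unit.\<close>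
lemma prime_power_roots_conjugate:
  fixes \<zeta> :: "'a::field_char_0" and g :: "int poly"
  assumes l: "Factorial_Ring.prime (l :: nat)" and a: "a \<ge> 1"
    and \<zeta>: "\<zeta> ^ (l ^ a) = 1" "\<zeta> ^ (l ^ (a - 1)) \<noteq> 1"
    and u: "\<not> l dvd u" and g: "ipoly g \<zeta> = 0"
  shows "ipoly g (\<zeta> ^ u) = 0"
proof -
  have l0: "l > 0" using prime_gt_0_nat[OF l] .
  have "algebraic \<zeta>"
    by (rule algebraic_root[of 1 "monom 1 (l ^ a)"]) (use l0 \<zeta> in \<open>auto simp: poly_monom degree_monom_eq\<close>)
  then obtain n where "alg_deg_le n \<zeta>" by (auto simp: algebraic_iff_alg_deg_le)
  then obtain p where p: "p \<noteq> 0" "ipoly p \<zeta> = 0" and dvd: "\<And>G. ipoly G \<zeta> = 0 \<Longrightarrow> p dvd G"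
    using primitive_minpoly_exists by blast
  define b where "b = l ^ (a - 1)"
  have bl: "b * l = l ^ a" using a by (simp add: b_def power_eq_if mult.commute)
  \<comment> \<open>the cyclotomic polynomial of order \<open>l\<^sup>a\<close>\<close>
  define \<Psi> where "\<Psi> = (\<Sum>i<l. monom 1 (b * i) :: int poly)"
  have \<Psi>: "ipoly \<Psi> z = 0" if "z ^ b \<noteq> 1" "z ^ (l ^ a) = 1" for z :: 'a
  proof -
    have "(\<Sum>i<l. (z ^ b) ^ i) = ((z ^ b) ^ l - 1) / (z ^ b - 1)"
      using that by (intro geometric_sum)
    also have "\<dots> = 0" using that(2) by (simp add: power_mult[symmetric] bl)
    finally show ?thesis by (simp add: \<Psi>_def power_mult)
  qed
  have ne: "(\<zeta> ^ u) ^ b \<noteq> 1"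
  proof
    assume *: "(\<zeta> ^ u) ^ b = 1"
    have "coprime u l" using l u by (simp add: prime_imp_coprime coprime_commute)
    then obtain x y where xy: "u * x = l * y + 1"
      using coprime_bezout_strong[of u l] l prime_nat_iff by auto
    have "(\<zeta> ^ b) ^ (u * x) = ((\<zeta> ^ u) ^ b) ^ x" by (simp add: power_mult[symmetric] ac_simps)
    also have "\<dots> = 1" using * by simp
    finally have "((\<zeta> ^ b) ^ l) ^ y * \<zeta> ^ b = 1" by (simp add: xy power_mult power_add mult.commute)
    moreover have "(\<zeta> ^ b) ^ l = 1" using \<zeta>(1) by (simp add: power_mult[symmetric] bl)
    ultimately have "\<zeta> ^ b = 1" by simp
    then show False using \<zeta>(2) by (simp add: b_def)
  qed
  have \<zeta>u: "(\<zeta> ^ u) ^ (l ^ a) = 1" using \<zeta>(1) by (metis power_commutes power_mult mult.commute power_one)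
  obtain h where h: "\<Psi> = p * h" using dvd[OF \<Psi>[of \<zeta>]] \<zeta> by (auto simp: b_def elim: dvdE)
  have "poly \<Psi> 1 = int l" by (simp add: \<Psi>_def poly_sum poly_monom)
  then have "int l = poly p 1 * poly h 1" by (simp add: h)
  moreover have "Factorial_Ring.prime (int l)" using l by simp
  ultimately have "\<bar>poly p 1\<bar> = 1 \<or> \<bar>poly h 1\<bar> = 1"
    using Factorial_Ring.irreducibleD prime_elem_imp_irreducible prime_imp_prime_elem zdvd1_eq
    by metis
  then have h1: "\<bar>poly h 1\<bar> = 1"
    using prime_power_root_value_at_one[OF l \<zeta>(1) p(2)] by simp
  have "ipoly \<Psi> (\<zeta> ^ u) = 0" using ne \<zeta>u by (rule \<Psi>)
  then have "ipoly p (\<zeta> ^ u) * ipoly h (\<zeta> ^ u) = 0" by (simp add: h)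
  moreover have "ipoly h (\<zeta> ^ u) \<noteq> 0"
    using prime_power_root_value_at_one[OF l \<zeta>u, of h] h1 by blast
  ultimately have "ipoly p (\<zeta> ^ u) = 0" by simp
  moreover obtain k where "g = p * k" using dvd[OF g] by (rule dvdE)
  ultimately show ?thesis by simp
qed

text \<open>The embedding that maps \<open>\<zeta>\<close> to its conjugate \<open>\<zeta>\<^sup>u\<close> is trivial after \<open>k!\<close> iterations, where it maps
\<open>\<zeta>\<close> to \<open>\<zeta>\<^bsup>u^(k!)\<^esup>\<close>.\<close>
lemma prime_power_torsion:
  fixes \<zeta> :: "'a::{alg_closed_field, field_char_0}"
  assumes l: "Factorial_Ring.prime (l :: nat)" and a: "a \<ge> 1"
    and \<zeta>: "\<zeta> ^ (l ^ a) = 1" "\<zeta> ^ (l ^ (a - 1)) \<noteq> 1"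
    and u: "\<not> l dvd u" and mem: "\<zeta> \<in> bounded_degree_field k"
  shows "\<zeta> ^ (u ^ fact k) = \<zeta>"
proof -
  have "algebraic \<zeta>" using mem by (rule bounded_degree_field_algebraic)
  then obtain f where f: "is_minpoly \<rat> \<zeta> f"
    using rats.minpoly_exists by (auto simp: algebraic_iff_alg_over)
  note f' = is_minpolyD[OF f]
  obtain d :: int and g where d: "d \<noteq> 0" "smult (of_int d) f = map_poly of_int g"
    using clear_denominators[OF f'(1)] by auto
  have "ipoly g \<zeta> = 0" using d(2)[symmetric] f'(3) by simp
  then have "ipoly g (\<zeta> ^ u) = 0"
    by (rule prime_power_roots_conjugate[OF l a \<zeta> u])
  then have "of_int d * poly f (\<zeta> ^ u) = 0" unfolding d(2)[symmetric] by simp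
  then have "poly f (\<zeta> ^ u) = 0" using d(1) by simp
  then have root: "poly (map_poly (\<lambda>x. x) f) (\<zeta> ^ u) = 0" by (simp add: map_poly_id')
  have emb: "field_embedding (\<rat> :: 'a set) (\<lambda>x. x)"
    by (rule identity_embedding[OF rats.subfield_ops_axioms])
  have "(\<rat> :: 'a set) \<subseteq> Collect algebraic" by (auto intro: rat_imp_algebraic)
  from field_embedding.extend_simple[OF emb this f root] obtain K \<sigma> where
    K: "field_embedding K \<sigma>" "K \<subseteq> Collect algebraic" "\<zeta> \<in> K" "\<sigma> \<zeta> = \<zeta> ^ u" by blast
  from bounded_degree_field_normal[OF mem K(1,2)] obtain L \<tau> S where
    L: "field_embedding L \<tau>" "\<forall>y\<in>K. \<tau> y = \<sigma> y" and S: "subfield_ops S" "\<zeta> \<in> S" "S \<subseteq> L"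
      "\<forall>y\<in>S. (\<tau> ^^ fact k) y = y" by blast
  interpret field_embedding S \<tau> by (rule field_embedding.restrict_hom[OF L(1) S(1,3)])
  have "(\<tau> ^^ n) \<zeta> = \<zeta> ^ (u ^ n)" for n
  proof (induction n)
    case (Suc n)
    then have "(\<tau> ^^ Suc n) \<zeta> = \<tau> \<zeta> ^ (u ^ n)" using S(2) by simp
    also have "\<tau> \<zeta> = \<zeta> ^ u" using K(3,4) L(2) by simp
    finally show ?case by (simp add: power_mult)
  qed simp
  then show ?thesis using S(2,4) by metis
qed

text \<open>The number \<open>u\<^bsup>k!\<^esup> - 1\<close> annihilates the roots of unity of order \<open>l\<^sup>a\<close> if \<open>u\<close> is prime to \<open>l\<close>. The choice
\<open>u = 2\<close> serves the odd primes \<open>l\<close> and \<open>u = 3\<close> serves \<open>l = 2\<close>.\<close>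
definition torsion_exponent :: "nat \<Rightarrow> nat"
  where "torsion_exponent k = (2 ^ fact k - 1) * (3 ^ fact k - 1)"

lemma torsion_exponent_pos: "torsion_exponent k > 0"
  using one_less_power[of "2::nat" "fact k"] one_less_power[of "3::nat" "fact k"]
  by (simp add: torsion_exponent_def)

lemma prime_power_torsion_exponent:
  fixes \<zeta> :: "'a::{alg_closed_field, field_char_0}"
  assumes l: "Factorial_Ring.prime (l :: nat)"
    and \<zeta>: "\<zeta> ^ (l ^ a) = 1" and mem: "\<zeta> \<in> bounded_degree_field k"
  shows "\<zeta> ^ torsion_exponent k = 1"
proof -
  define b where "b = (LEAST b. \<zeta> ^ (l ^ b) = 1)"
  have b: "\<zeta> ^ (l ^ b) = 1" unfolding b_def by (rule LeastI[of _ a]) (rule \<zeta>)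
  have min: "b \<le> c" if "\<zeta> ^ (l ^ c) = 1" for c unfolding b_def by (rule Least_le) (rule that)
  show ?thesis
  proof (cases "b = 0")
    case True
    with b show ?thesis by simp
  next
    case False
    then have b': "b \<ge> 1" "\<zeta> ^ (l ^ (b - 1)) \<noteq> 1" using min[of "b - 1"] by auto
    have "\<zeta> \<noteq> 0" using b l by (auto simp: power_0_left split: if_splits)
    have fixed: "\<zeta> ^ (u ^ fact k - 1) = 1" if "\<not> l dvd u" "u > 0" for u
    proof -
      have "\<zeta> ^ (u ^ fact k) = \<zeta>"
        by (rule prime_power_torsion[OF l b'(1) b b'(2) that(1) mem])
      moreover have "\<zeta> ^ (u ^ fact k) = \<zeta> ^ (u ^ fact k - 1) * \<zeta>"
        using that(2) by (simp flip: power_Suc2)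
      ultimately show ?thesis using \<open>\<zeta> \<noteq> 0\<close> by simp
    qed
    show ?thesis
    proof (cases "l = 2")
      case True
      then have "\<zeta> ^ (3 ^ fact k - 1) = 1" using fixed[of 3] by simp
      then have "(\<zeta> ^ (3 ^ fact k - 1)) ^ (2 ^ fact k - 1) = 1" by simp
      then show ?thesis unfolding torsion_exponent_def by (metis power_mult mult.commute)
    next
      case False
      then have "\<not> l dvd 2" using l by (metis primes_dvd_imp_eq two_is_prime_nat)
      then have "\<zeta> ^ (2 ^ fact k - 1) = 1" using fixed[of 2] by simp
      then show ?thesis by (simp add: torsion_exponent_def power_mult)
    qed
  qed
qed

text \<open>The order of \<open>\<zeta>\<^sup>w\<close>, where \<open>w\<close> is the exponent, is prime to every \<open>l\<close>: it divides the part of \<open>g\<close>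
that is prime to \<open>l\<close>, because \<open>w\<close> annihilates the \<open>l\<close>-primary part.\<close>
theorem bounded_degree_field_torsion:
  fixes \<zeta> :: "'a::{alg_closed_field, field_char_0}"
  assumes "\<zeta> ^ g = 1" "g \<ge> 1" and mem: "\<zeta> \<in> bounded_degree_field k"
  shows "\<zeta> ^ torsion_exponent k = 1"
proof -
  interpret subfield_ops "bounded_degree_field k :: 'a set" by (rule bounded_degree_field_ops)
  define \<eta> where "\<eta> = \<zeta> ^ torsion_exponent k"
  define d where "d = (LEAST d. d \<ge> 1 \<and> \<eta> ^ d = 1)"
  have "\<eta> ^ g = 1" using assms(1) by (metis \<eta>_def power_mult mult.commute power_one)
  then have d: "d \<ge> 1" "\<eta> ^ d = 1"
    using LeastI[of "\<lambda>d. d \<ge> 1 \<and> \<eta> ^ d = 1" g] assms(2) by (auto simp: d_def)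
  have min: "d \<le> c" if "c \<ge> 1" "\<eta> ^ c = 1" for c unfolding d_def by (rule Least_le) (use that in simp)
  have dvd: "d dvd n" if "\<eta> ^ n = 1" for n
  proof -
    have "\<eta> ^ n = (\<eta> ^ d) ^ (n div d) * \<eta> ^ (n mod d)"
      by (simp flip: power_mult power_add)
    then have "\<eta> ^ (n mod d) = 1" using that d by simp
    then have "n mod d = 0" using min[of "n mod d"] d(1) mod_less_divisor[of d n] by fastforce
    then show ?thesis by auto
  qed
  have "d = 1"
  proof (rule ccontr)
    assume "d \<noteq> 1"
    then obtain l where l: "Factorial_Ring.prime l" "l dvd d" using prime_factor_nat by blast
    obtain m where m: "g = l ^ multiplicity l g * m" "\<not> l dvd m"
      using multiplicity_decompose'[of g l] assms(2) l(1) by (metis not_one_le_zero not_prime_unit)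
    define a where "a = multiplicity l g"
    have "(\<zeta> ^ m) ^ (l ^ a) = 1" using assms(1) m(1) by (metis a_def power_mult mult.commute)
    then have "(\<zeta> ^ m) ^ torsion_exponent k = 1"
      using mem by (intro prime_power_torsion_exponent[OF l(1)]) simp_all
    then have "\<eta> ^ m = 1" by (metis \<eta>_def power_mult mult.commute)
    then show False using dvd l(2) m(2) dvd_trans by blast
  qed
  then show ?thesis using d by (simp add: \<eta>_def)
qed

section \<open>Divisibility modulo torsion\<close>

text \<open>The equation \<open>\<gamma>\<^bsup>e g\<^esup> = \<alpha>\<^sup>g\<close> says that \<open>\<alpha>\<close> is an \<open>e\<close>-th power of \<open>\<gamma>\<close> up to a \<open>g\<close>-th root of unity. The
bound on \<open>e\<close> therefore concerns divisibility in the multiplicative group modulo torsion. Good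
heredity needs this form, because norms of roots of \<open>x\<^sup>n - \<alpha>\<close> are only controlled up to torsion.\<close>
definition radically_bounded :: "'a::field set \<Rightarrow> 'a \<Rightarrow> nat \<Rightarrow> bool"
  where "radically_bounded M \<alpha> B \<longleftrightarrow>
    (\<forall>e g. \<forall>\<gamma>\<in>M. e \<ge> 1 \<longrightarrow> g \<ge> 1 \<longrightarrow> \<gamma> ^ (e * g) = \<alpha> ^ g \<longrightarrow> e \<le> B)"

text \<open>An embedding that fixes \<open>\<alpha>\<close> multiplies \<open>\<gamma>\<close> by a root of unity of the field. It thus fixes
\<open>\<gamma>\<^sup>w\<close>, where \<open>w\<close> annihilates these roots of unity. An element that all embeddings over
\<open>\<rat>(\<alpha>)\<close> fix lies in \<open>\<rat>(\<alpha>)\<close>.\<close>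
lemma torsion_power_in_simple_extension:
  fixes \<alpha> \<gamma> :: "'a::{alg_closed_field, field_char_0}"
  assumes \<alpha>: "\<alpha> \<in> bounded_degree_field k" "\<alpha> \<noteq> 0" and \<gamma>: "\<gamma> \<in> bounded_degree_field k"
    and m: "m \<ge> 1" "\<gamma> ^ m = \<alpha> ^ j"
  shows "\<gamma> ^ torsion_exponent k \<in> (\<lambda>p. poly p \<alpha>) ` polys \<rat>"
proof (rule ccontr)
  interpret M: subfield_ops "bounded_degree_field k :: 'a set" by (rule bounded_degree_field_ops)
  define K where "K = (\<lambda>p. poly p \<alpha>) ` polys (\<rat> :: 'a set)"
  define w where "w = torsion_exponent k"
  assume "\<not> \<gamma> ^ torsion_exponent k \<in> (\<lambda>p. poly p \<alpha>) ` polys \<rat>"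
  then have notin: "\<gamma> ^ w \<notin> K" by (simp add: K_def w_def)
  have alg: "algebraic \<alpha>" "algebraic (\<gamma> ^ w)"
    using \<alpha> M.power_mem[OF \<gamma>] bounded_degree_field_algebraic by blast+
  have Q: "(\<rat> :: 'a set) \<subseteq> Collect algebraic" by (auto intro: rat_imp_algebraic)
  have K: "subfield_ops K" "K \<subseteq> Collect algebraic"
    unfolding K_def using simple_extension_ops[OF rats.subfield_ops_axioms Q alg(1)]
      simple_extension_algebraic[OF Q alg(1)] by blast+
  interpret K: subfield_ops K by fact
  have \<alpha>K: "\<alpha> \<in> K" unfolding K_def by (intro image_eqI[of _ _ "[:0, 1:]"]) simp_all
  obtain L \<tau> where L: "field_embedding L \<tau>" "L \<subseteq> Collect algebraic" "K \<subseteq> L" "\<gamma> ^ w \<in> L"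
      "\<forall>x\<in>K. \<tau> x = x" "\<tau> (\<gamma> ^ w) \<noteq> \<gamma> ^ w"
    using embedding_moving[OF K alg(2) notin] by blast
  obtain L' \<tau>' S where L': "field_embedding L' \<tau>'" "L \<subseteq> L'" "\<forall>y\<in>L. \<tau>' y = \<tau> y" and
    S: "\<gamma> \<in> S" "S \<subseteq> L'" "S \<subseteq> bounded_degree_field k" "\<forall>y\<in>S. \<tau>' y \<in> S"
    using bounded_degree_field_normal[OF \<gamma> L(1,2)] by blast
  interpret field_embedding L' \<tau>' by fact
  have \<gamma>L: "\<gamma> \<in> L'" using S by blast
  have "\<tau>' \<gamma> ^ m = \<tau>' (\<gamma> ^ m)" using \<gamma>L by simp
  also have "\<dots> = \<alpha> ^ j" using L(3,5) L'(3) K.power_mem[OF \<alpha>K, of j] unfolding m(2) by auto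
  also have "\<dots> = \<gamma> ^ m" using m(2) by simp
  finally have "(\<tau>' \<gamma> / \<gamma>) ^ m = 1"
    using \<alpha>(2) by (simp add: power_divide m(2))
  moreover have "\<tau>' \<gamma> / \<gamma> \<in> bounded_degree_field k" using S(1,3,4) by (simp add: subset_iff)
  ultimately have "(\<tau>' \<gamma> / \<gamma>) ^ w = 1"
    unfolding w_def using m(1) by (intro bounded_degree_field_torsion)
  moreover have "\<gamma> \<noteq> 0" using m \<alpha>(2) by (metis not_one_le_zero power_0_left power_eq_0_iff)
  ultimately have "\<tau>' \<gamma> ^ w = \<gamma> ^ w" by (simp add: power_divide)
  then have "\<tau>' (\<gamma> ^ w) = \<gamma> ^ w" using \<gamma>L by simp
  then show False using L L'(3) by simp
qed

text \<open>Powers with the torsion exponent move the equation \<open>\<gamma>\<^bsup>e g\<^esup> = \<alpha>\<^sup>g\<close> into the number field \<open>\<rat>(\<alpha>)\<close>,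
whose elements have bounded degree. There only finitely many exponents occur.\<close>
theorem bounded_degree_field_radically_bounded:
  fixes \<alpha> :: "'a::{alg_closed_field, field_char_0}"
  assumes \<alpha>: "\<alpha> \<in> bounded_degree_field k" "\<alpha> \<noteq> 0" "\<not> root_of_unity \<alpha>"
  shows "\<exists>B. radically_bounded (bounded_degree_field k) \<alpha> B"
proof -
  interpret M: subfield_ops "bounded_degree_field k :: 'a set" by (rule bounded_degree_field_ops)
  define w where "w = torsion_exponent k"
  have w: "w \<ge> 1" unfolding w_def using torsion_exponent_pos[of k] by simp
  have alg: "algebraic \<alpha>" using \<alpha>(1) by (rule bounded_degree_field_algebraic)
  then obtain n where n: "alg_deg_le n \<alpha>" by (auto simp: algebraic_iff_alg_deg_le)
  \<comment> \<open>one factor \<open>w\<close> moves \<open>\<gamma>\<close> into \<open>\<rat>(\<alpha>)\<close>, the other removes the remaining \<open>g\<close>-th root of unity\<close>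
  define E where "E = {e. e \<ge> 1 \<and> (\<exists>\<delta>. alg_deg_le n \<delta> \<and> \<delta> ^ e = \<alpha> ^ (w * w))}"
  have "\<not> root_of_unity (\<alpha> ^ (w * w))"
  proof
    assume "root_of_unity (\<alpha> ^ (w * w))"
    then obtain m where "m \<ge> 1" "(\<alpha> ^ (w * w)) ^ m = 1" by (auto simp: root_of_unity_def)
    then have "w * w * m \<ge> 1" "\<alpha> ^ (w * w * m) = 1" using w by (simp_all add: power_mult)
    then show False using \<alpha>(3) by (auto simp: root_of_unity_def)
  qed
  moreover have "algebraic (\<alpha> ^ (w * w))"
    using M.power_mem[OF \<alpha>(1)] bounded_degree_field_algebraic by blast
  ultimately have "finite E" unfolding E_def using \<alpha>(2) by (intro bounded_degree_exponents) simp_all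
  have "e \<in> E" if e: "e \<ge> 1" "g \<ge> 1" "\<gamma> \<in> bounded_degree_field k" "\<gamma> ^ (e * g) = \<alpha> ^ g" for e g \<gamma>
  proof -
    define \<delta> where "\<delta> = \<gamma> ^ w"
    have "e * g \<ge> 1" using e by simp
    from torsion_power_in_simple_extension[OF \<alpha>(1,2) e(3) this e(4)]
    obtain p where p: "p \<in> polys \<rat>" "\<delta> = poly p \<alpha>" by (auto simp: \<delta>_def w_def)
    have deg: "alg_deg_le n (\<delta> ^ w)"
      using alg_deg_le_poly[OF n rats.polys_power[OF p(1)], of w] by (simp add: p(2) poly_power)
    have "(\<delta> ^ e / \<alpha> ^ w) ^ g = (\<gamma> ^ (e * g) / \<alpha> ^ g) ^ w"
      by (simp add: \<delta>_def power_divide ac_simps flip: power_mult)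
    also have "\<dots> = 1" using e(4) \<alpha>(2) by simp
    finally have "(\<delta> ^ e / \<alpha> ^ w) ^ w = 1"
      unfolding w_def using e(2,3) \<alpha>(1) by (intro bounded_degree_field_torsion) (auto simp: \<delta>_def)
    then have "(\<delta> ^ w) ^ e = \<alpha> ^ (w * w)"
      using \<alpha>(2) by (simp add: power_divide ac_simps flip: power_mult)
    with e(1) deg show ?thesis unfolding E_def by blast
  qed
  then have "radically_bounded (bounded_degree_field k) \<alpha> (Max (insert 0 E))"
    unfolding radically_bounded_def using \<open>finite E\<close> by (auto intro!: Max_ge)
  then show ?thesis ..
qed

lemma subfield_rootless:
  fixes F :: "'a::{alg_closed_field, field_char_0} set"
  assumes "F \<subseteq> bounded_degree_field k"
  shows "rootless_field F"
  unfolding rootless_field_def rootless_elem_def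
proof (intro ballI impI)
  fix f assume "f \<in> F" "f \<noteq> 0 \<and> \<not> root_of_unity f"
  then obtain B where B: "radically_bounded (bounded_degree_field k) f B"
    using bounded_degree_field_radically_bounded[of f k] assms by blast
  have "{n. n \<ge> 1 \<and> (\<exists>x\<in>F. x ^ n = f)} \<subseteq> {..B}"
  proof
    fix n assume "n \<in> {n. n \<ge> 1 \<and> (\<exists>x\<in>F. x ^ n = f)}"
    then obtain x where "n \<ge> 1" "x \<in> F" "x ^ n = f" by blast
    then show "n \<in> {..B}"
      using B[unfolded radically_bounded_def, rule_format, of x n 1] assms by auto
  qed
  then show "finite {n. n \<ge> 1 \<and> (\<exists>x\<in>F. x ^ n = f)}" by (rule finite_subset) simp
qed

section \<open>Good heredity\<close>

text \<open>Let \<open>d\<close> be the degree of \<open>\<beta>\<close> over \<open>M\<close> and \<open>c\<close> the product of its conjugates, which all satisfy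
\<open>x\<^sup>n = \<alpha>\<close>. Then \<open>c\<^sup>n = \<alpha>\<^sup>d\<close>, and with \<open>g = gcd d n\<close> some \<open>\<gamma> = c\<^sup>x / \<alpha>\<^sup>y\<close> in \<open>M\<close> satisfies
\<open>\<gamma>\<^sup>n = \<alpha>\<^sup>g\<close>. As \<open>g \<le> d\<close>, the bound on \<open>n / g\<close> is also one on \<open>n / d\<close>.\<close>
lemma factor_degree_bound:
  fixes M :: "'a::alg_closed_field set"
  assumes M: "subfield_ops M" and \<alpha>: "\<alpha> \<in> M" "\<alpha> \<noteq> 0" "radically_bounded M \<alpha> B"
    and Q: "Q \<in> polys M" "Q \<noteq> 0" "poly Q \<beta> = 0" and n: "n \<ge> 1" "\<beta> ^ n = \<alpha>"
  shows "n \<le> B * degree Q"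
proof -
  interpret subfield_ops M by fact
  obtain D where "is_minpoly M \<beta> D"
    using minpoly_exists[of \<beta>] Q by (auto simp: alg_over_def)
  note D = is_minpolyD[OF this]
  have "D dvd Q" using D(6)[OF Q(1,3)] .
  then have deg: "degree D \<le> degree Q" using Q(2) by (rule dvd_imp_degree_le)
  have "D dvd monom 1 n - [:\<alpha>:]"
    using \<alpha> n by (intro D(6)) (auto simp: poly_monom)
  then have roots: "x ^ n = \<alpha>" if "poly D x = 0" for x
    using that by (auto simp: poly_monom elim!: dvdE dest!: arg_cong[of _ _ "\<lambda>p. poly p x"])
  obtain A where A: "size A = degree D" "D = (\<Prod>x\<in>#A. [:-x, 1:])"
    using alg_closed_imp_factorization[OF D(4)] D(2) by auto
  define d where "d = degree D"
  have d: "d \<ge> 1" using root_relation(1)[OF D(4,3)] by (simp add: d_def)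
  define c where "c = prod_mset A"
  have "poly (\<Prod>x\<in>#A. [:-x, 1:]) 0 = (- 1) ^ size A * prod_mset A" for A :: "'a multiset"
    by (induction A) auto
  then have "poly D 0 = (- 1) ^ d * c" using A by (simp add: c_def d_def)
  then have "c = (- 1) ^ d * poly D 0" by (simp flip: mult.assoc power_add)
  then have cM: "c \<in> M" using D(1) by simp
  have "\<forall>x\<in>#A. poly D x = 0"
    by (subst A(2)) (auto simp: poly_prod_mset prod_mset_zero_iff)
  then have "\<forall>x\<in>#A. x ^ n = \<alpha>" using roots by blast
  then have "prod_mset A ^ n = \<alpha> ^ size A"
    by (induction A) (auto simp: power_mult_distrib)
  then have cn: "c ^ n = \<alpha> ^ d" by (simp add: c_def A(1) d_def)
  define g where "g = gcd d n"
  have g: "g \<ge> 1" "g \<le> d" "g dvd n" using d by (auto simp: g_def Suc_le_eq intro: dvd_imp_le)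
  obtain x y where xy: "d * x = n * y + g" using bezout_nat[of d n] d by (auto simp: g_def)
  define \<gamma> where "\<gamma> = c ^ x / \<alpha> ^ y"
  have "\<gamma> ^ n = (c ^ n) ^ x / \<alpha> ^ (n * y)"
    by (simp add: \<gamma>_def power_divide mult.commute flip: power_mult)
  also have "\<dots> = \<alpha> ^ g" using \<alpha>(2) by (simp add: cn xy power_add flip: power_mult)
  finally have "\<gamma> ^ (n div g * g) = \<alpha> ^ g" using g(3) by simp
  moreover have "\<gamma> \<in> M" unfolding \<gamma>_def using cM \<alpha> by simp
  moreover have "n div g \<ge> 1" using g n by (simp add: Suc_le_eq div_greater_zero_iff dvd_imp_le)
  ultimately have "n div g \<le> B" using \<alpha>(3) g(1) by (auto simp: radically_bounded_def)
  then have "n div g * g \<le> B * degree Q" using g(2) deg by (intro mult_le_mono) (auto simp: d_def)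
  then show ?thesis using g(3) by simp
qed

lemma polys_over_simps [simp]:
  "carrier (polys_over F) = polys (F :: 'a::field set)"
  "p \<otimes>\<^bsub>polys_over F\<^esub> q = p * q" "\<one>\<^bsub>polys_over F\<^esub> = 1" "\<zero>\<^bsub>polys_over F\<^esub> = 0"
  by (simp_all add: polys_over_def ring_of_type_algebra_def polys_def)

lemma const_unit_polys_over:
  assumes "subfield_ops F" "c \<in> F" "c \<noteq> 0"
  shows "[:c:] \<in> Units (polys_over F)"
proof -
  interpret subfield_ops F by fact
  show ?thesis
    unfolding Units_def using assms by (auto intro!: bexI[of _ "[:inverse c:]"] simp: one_pCons)
qed

lemma irreducible_overI:
  assumes F: "subfield_ops F" and R: "R \<in> polys F" "degree R > 0"
    and no: "\<And>A C. A \<in> polys F \<Longrightarrow> C \<in> polys F \<Longrightarrow> degree A > 0 \<Longrightarrow> degree C > 0 \<Longrightarrow> R \<noteq> A * C"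
  shows "irreducible_over F R"
proof -
  interpret subfield_ops F by fact
  have R0: "R \<noteq> 0" using R(2) by auto
  have "R \<notin> Units (polys_over F)"
  proof
    assume "R \<in> Units (polys_over F)"
    then obtain C where "R * C = 1" by (auto simp: Units_def)
    then have "R dvd 1" by (metis dvd_triv_left)
    then have "degree R \<le> degree (1 :: 'a poly)" by (intro dvd_imp_degree_le) simp_all
    with R(2) show False by simp
  qed
  moreover have "A \<in> Units (polys_over F)"
    if A: "A \<in> polys F" and pf: "properfactor (polys_over F) A R" for A
  proof -
    obtain C where C: "C \<in> polys F" "R = A * C" using pf by (auto simp: properfactor_def factor_def)
    have "degree A = 0 \<or> degree C = 0" using no[OF A C(1)] C(2) by auto
    then show ?thesis
    proof
      assume "degree A = 0"
      then obtain c where "A = [:c:]" by (rule degree_eq_zeroE)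
      with A C R0 show ?thesis using const_unit_polys_over[OF F, of c] by auto
    next
      assume "degree C = 0"
      then obtain c where c: "C = [:c:]" by (rule degree_eq_zeroE)
      with C R0 have c0: "c \<noteq> 0" "c \<in> F" by auto
      then have "A = R * [:inverse c:]" using C(2) c by simp
      moreover have "[:inverse c:] \<in> polys F" using c0 by simp
      ultimately have "factor (polys_over F) R A" unfolding factor_def polys_over_simps by blast
      with pf show ?thesis by (simp add: properfactor_def)
    qed
  qed
  ultimately show ?thesis
    using R(1) R0 by (auto simp: irreducible_over_def ring_irreducible_def Divisibility.irreducible_def)
qed

lemma subst_power_mult: "subst_power (P * Q) n = subst_power P n * subst_power Q n"
  by (simp add: subst_power_def pcompose_mult)

lemma subst_power_smult: "subst_power (smult c P) n = smult c (subst_power P n)"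
  by (simp add: subst_power_def pcompose_smult)

lemma subst_power_prod_list: "subst_power (prod_list Qs) n = prod_list (map (\<lambda>Q. subst_power Q n) Qs)"
  by (induction Qs) (simp_all add: subst_power_mult, simp add: subst_power_def pcompose_1)

lemma subst_power_subst_power: "subst_power (subst_power P n) m = subst_power P (n * m)"
proof -
  have "pcompose (monom 1 n) (monom 1 m) = (monom 1 (n * m) :: 'a poly)"
    by (induction n) (simp_all add: monom_0 monom_Suc pcompose_pCons pcompose_1 mult_monom flip: one_pCons)
  then show ?thesis by (simp add: subst_power_def pcompose_assoc[symmetric])
qed

lemma degree_subst_power: "degree (subst_power P n) = degree P * n"
  by (simp add: subst_power_def degree_pcompose degree_monom_eq)

lemma poly_subst_power: "poly (subst_power P n) x = poly P (x ^ n)"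
  by (simp add: subst_power_def poly_pcompose poly_monom)

lemma (in subfield_ops) polys_subst_power [simp]: "P \<in> polys K \<Longrightarrow> subst_power P n \<in> polys K"
  by (simp add: subst_power_def)

lemma degree_prod_list_ge:
  fixes Qs :: "'a::field poly list"
  assumes "\<And>Q. Q \<in> set Qs \<Longrightarrow> Q \<noteq> 0 \<and> n \<le> B * degree Q"
  shows "prod_list Qs \<noteq> 0 \<and> n * length Qs \<le> B * degree (prod_list Qs)"
  using assms
proof (induction Qs)
  case (Cons Q Qs)
  then show ?case by (fastforce simp: degree_mult_eq distrib_left intro: add_mono)
qed simp

text \<open>If all nonconstant factors of \<open>P(x\<^sup>n)\<close> have degree at least \<open>n / B\<close>, then a product of nonconstant factors that equals \<open>P(x\<^sup>n)\<close> has at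
most \<open>B deg P\<close> factors. Take \<open>n\<close> and a product with the largest number of factors. If some
\<open>Q(x\<^sup>m)\<close> split for a factor \<open>Q\<close>, then \<open>P(x\<^bsup>n m\<^esup>)\<close> would have more factors.\<close>
theorem poly_good_heredityI:
  fixes P :: "'a::field poly"
  assumes F: "subfield_ops F" and P: "P \<in> polys F" "P \<noteq> 0"
    and bound: "\<And>n Q. n \<ge> 1 \<Longrightarrow> Q \<in> polys F \<Longrightarrow> degree Q > 0 \<Longrightarrow> Q dvd subst_power P n \<Longrightarrow>
      n \<le> B * degree Q"
  shows "poly_good_heredity F P"
proof -
  interpret subfield_ops F by fact
  define fac where "fac = (\<lambda>(n, c, Qs). n \<ge> 1 \<and> c \<in> F \<and> c \<noteq> 0 \<and>
    (\<forall>Q\<in>set Qs. Q \<in> polys F \<and> degree Q > 0) \<and> subst_power P n = smult c (prod_list Qs))"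
  define len where "len = (\<lambda>(n::nat, c::'a, Qs :: 'a poly list). length Qs)"
  have "len t < Suc (B * degree P)" if "fac t" for t
  proof -
    obtain n c Qs where t: "t = (n, c, Qs)" by (cases t)
    have f: "n \<ge> 1" "c \<noteq> 0" "\<And>Q. Q \<in> set Qs \<Longrightarrow> Q \<in> polys F \<and> degree Q > 0"
        "subst_power P n = smult c (prod_list Qs)"
      using that by (auto simp: t fac_def)
    have "Q \<noteq> 0 \<and> n \<le> B * degree Q" if Q: "Q \<in> set Qs" for Q
    proof -
      have "Q dvd subst_power P n"
        unfolding f(4) using Q by (intro dvd_smult) (rule prod_list_dvd)
      then show ?thesis using bound[OF f(1)] f(3)[OF Q] by auto
    qed
    then have "n * length Qs \<le> B * degree (prod_list Qs)" using degree_prod_list_ge by blast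
    also have "degree (prod_list Qs) = degree P * n"
      using arg_cong[OF f(4), of degree] f(2) by (simp add: degree_subst_power)
    finally have "n * length Qs \<le> n * (B * degree P)" by (simp add: ac_simps)
    then show ?thesis using f(1) by (simp add: t len_def)
  qed
  moreover have "\<exists>t. fac t"
  proof (cases "degree P = 0")
    case True
    then obtain c where c: "P = [:c:]" by (rule degree_eq_zeroE)
    have "fac (1, c, [])" using P c by (simp add: fac_def subst_power_def)
    then show ?thesis ..
  next
    case False
    then have "fac (1, 1, [P])" using P by (simp add: fac_def subst_power_def monom_altdef)
    then show ?thesis ..
  qed
  ultimately obtain t where t: "fac t" and max: "\<And>t'. fac t' \<Longrightarrow> len t' \<le> len t"
    using Lattices_Big.ex_has_greatest_nat[of fac _ len "Suc (B * degree P)"] by blast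
  obtain n c Qs where t_eq: "t = (n, c, Qs)" by (cases t)
  have f: "n \<ge> 1" "c \<in> F" "c \<noteq> 0" "\<And>Q. Q \<in> set Qs \<Longrightarrow> Q \<in> polys F \<and> degree Q > 0"
      "subst_power P n = smult c (prod_list Qs)"
    using t by (auto simp: t_eq fac_def)
  have "hereditarily_irreducible F Q" if Q: "Q \<in> set Qs" for Q
    unfolding hereditarily_irreducible_def
  proof (intro allI impI irreducible_overI F)
    fix m :: nat assume m: "m \<ge> 1"
    show "subst_power Q m \<in> polys F" "degree (subst_power Q m) > 0"
      using f(4)[OF Q] m by (simp_all add: degree_subst_power)
    fix A C assume AC: "A \<in> polys F" "C \<in> polys F" "degree A > 0" "degree C > 0"
    show "subst_power Q m \<noteq> A * C"
    proof
      assume eq: "subst_power Q m = A * C"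
      obtain Q1 Q2 where split: "Qs = Q1 @ Q # Q2" using Q by (meson split_list)
      define Rs where "Rs = map (\<lambda>Q. subst_power Q m) Q1 @ A # C # map (\<lambda>Q. subst_power Q m) Q2"
      have "subst_power P (n * m) = smult c (prod_list (map (\<lambda>Q. subst_power Q m) Qs))"
        by (simp add: f(5) subst_power_smult subst_power_prod_list flip: subst_power_subst_power)
      also have "prod_list (map (\<lambda>Q. subst_power Q m) Qs) = prod_list Rs"
        by (simp add: Rs_def split eq mult.assoc)
      finally have "fac (n * m, c, Rs)"
        using f m AC by (auto simp: fac_def Rs_def split degree_subst_power)
      then have "length Rs \<le> length Qs" using max by (auto simp: len_def t_eq)
      then show False by (simp add: Rs_def split)
    qed
  qed
  then show ?thesis
    unfolding poly_good_heredity_def using f by blast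
qed

text \<open>The field \<open>M\<close> contains \<open>F\<close> and all roots of \<open>P\<close>. A root \<open>\<beta>\<close> of a factor of \<open>P(x\<^sup>n)\<close> has a root of
\<open>P\<close> as its \<open>n\<close>-th power, so the degree of \<open>\<beta>\<close> over \<open>M\<close>, and hence that of the factor, grows
at least proportionally to \<open>n\<close>.\<close>
theorem subfield_good_heredity:
  fixes F :: "'a::{alg_closed_field, field_char_0} set"
  assumes F: "subfield_ops F" "F \<subseteq> bounded_degree_field k"
  shows "field_good_heredity F"
  unfolding field_good_heredity_def
proof (intro ballI impI)
  fix P assume "P \<in> carrier (polys_over F)"
    and nz: "\<forall>z. poly P z = 0 \<longrightarrow> z \<noteq> 0 \<and> \<not> root_of_unity z"
  then have P: "P \<in> polys F" "P \<noteq> 0" by auto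
  define Z where "Z = {z. poly P z = 0}"
  have Z: "finite Z" unfolding Z_def using P(2) by (rule poly_roots_finite)
  have F_alg: "F \<subseteq> Collect algebraic" using F(2) bounded_degree_field_algebraic by blast
  have "algebraic z" if "z \<in> Z" for z
    using that P polys_mono[OF F_alg] unfolding Z_def
    by (intro alg_over_algebraics) (auto simp: alg_over_def)
  then obtain l where l: "l \<ge> k" "Z \<subseteq> bounded_degree_field l"
    using algebraic_finite_set_in_bounded_degree_field[OF Z] by blast
  define M where "M = (bounded_degree_field l :: 'a set)"
  have M: "subfield_ops M" unfolding M_def by (rule bounded_degree_field_ops)
  have FM: "F \<subseteq> M" unfolding M_def using F(2) bounded_degree_field_mono[OF l(1)] by blast
  have "\<exists>B. radically_bounded M z B" if "z \<in> Z" for z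
    unfolding M_def using that l(2) nz by (intro bounded_degree_field_radically_bounded) (auto simp: Z_def)
  then obtain b where b: "\<And>z. z \<in> Z \<Longrightarrow> radically_bounded M z (b z)" by metis
  define B where "B = sum b Z"
  show "poly_good_heredity F P"
  proof (rule poly_good_heredityI[OF F(1) P, where B = B])
    fix n Q assume n: "n \<ge> 1" and Q: "Q \<in> polys F" "degree Q > 0" "Q dvd subst_power P n"
    obtain \<beta> where \<beta>: "poly Q \<beta> = 0" using alg_closed_imp_poly_has_root[OF Q(2)] by blast
    then have "poly (subst_power P n) \<beta> = 0" using Q(3) by auto
    then have \<beta>n: "\<beta> ^ n \<in> Z" by (simp add: poly_subst_power Z_def)
    have "n \<le> b (\<beta> ^ n) * degree Q"
    proof (rule factor_degree_bound[OF M _ _ b[OF \<beta>n]])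
      show "\<beta> ^ n \<in> M" using \<beta>n l(2) by (auto simp: M_def)
      show "\<beta> ^ n \<noteq> 0" using \<beta>n nz by (auto simp: Z_def)
      show "Q \<in> polys M" using Q(1) FM polys_mono by blast
    qed (use \<beta> Q(2) n in auto)
    also have "b (\<beta> ^ n) \<le> B" unfolding B_def using \<beta>n Z by (intro member_le_sum) auto
    finally show "n \<le> B * degree Q" by simp
  qed
qed

section \<open>Finite extensions\<close>

lemma ambient_nat_pow [simp]: "x [^]\<^bsub>ambient\<^esub> (n::nat) = (x::'a::field) ^ n"
proof -
  interpret ring "ambient :: 'a ring" by rule
  show ?thesis by (induction n) simp_all
qed

text \<open>The polynomials of the algebra library are lists with the leading coefficient first.\<close>
lemma eval_eq_poly: "ring.eval ambient p x = poly (Poly (rev p)) (x :: 'a::field)"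
proof -
  interpret ring "ambient :: 'a ring" by rule
  show ?thesis
    by (induction p) (simp_all add: Poly_append poly_monom)
qed

lemma alg_over_if_algebraic_over:
  fixes K :: "'a::field set"
  assumes K: "subfield K ambient" and x: "(ring.algebraic ambient over K) x"
  shows "alg_over K x"
proof -
  interpret R: field "ambient :: 'a ring" by rule
  obtain p where p: "p \<in> carrier (K[X]\<^bsub>ambient\<^esub>)" "p \<noteq> []" "R.eval p x = 0"
    using R.algebraicE[OF subfieldE(1)[OF K] _ x] by auto
  then have p': "set p \<subseteq> K" "hd p \<noteq> 0"
    by (auto simp: univ_poly_def polynomial_def)
  interpret K: subfield_ops K using K by (simp add: subfield_iff_ops)
  have "coeff (Poly (rev p)) i \<in> K" for i
    using p'(1) by (auto simp: nth_default_def) (metis length_rev nth_mem set_rev subsetD)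
  then have "Poly (rev p) \<in> polys K" by (simp add: polys_def)
  moreover have "Poly (rev p) \<noteq> 0"
  proof
    assume "Poly (rev p) = 0"
    then have "coeff (Poly (rev p)) (length p - 1) = 0" by simp
    then show False using p(2) p'(2) by (simp add: nth_default_def rev_nth hd_conv_nth)
  qed
  ultimately show ?thesis using p(3) by (auto simp: alg_over_def eval_eq_poly)
qed

lemma finite_extension_in_bounded_degree_field:
  fixes K E :: "'a::{alg_closed_field, field_char_0} set"
  assumes ext: "finite_extension K E" and K_sub: "K \<subseteq> bounded_degree_field k"
  shows "\<exists>l. E \<subseteq> bounded_degree_field l"
proof -
  interpret R: field "ambient :: 'a ring" by rule
  have K: "subfield K ambient" and E: "subfield E ambient" and fin: "R.finite_dimension K E"
    using ext by (auto simp: finite_extension_def)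
  have K_alg: "K \<subseteq> Collect algebraic" using K_sub bounded_degree_field_algebraic by blast
  obtain n where dim: "R.dimension n K E" using fin by (auto simp: R.finite_dimension_def)
  then obtain Vs where Vs: "R.Span K Vs = E" "set Vs \<subseteq> E"
    using R.exists_base[OF K dim] R.Span_base_incl[OF K] by blast
  have "algebraic v" if v: "v \<in> set Vs" for v
  proof -
    have "alg_over K v"
      using R.finite_dimension_imp_algebraic[OF K subfieldE(1)[OF E] fin] Vs(2) v
      by (intro alg_over_if_algebraic_over[OF K]) blast
    then have "alg_over (Collect algebraic) v"
      using polys_mono[OF K_alg] by (auto simp: alg_over_def)
    then show ?thesis by (rule alg_over_algebraics)
  qed
  then obtain l where l: "l \<ge> k" "set Vs \<subseteq> bounded_degree_field l"
    using algebraic_finite_set_in_bounded_degree_field[of "set Vs" k] by auto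
  interpret M: subfield_ops "bounded_degree_field l :: 'a set" by (rule bounded_degree_field_ops)
  have K_sub': "K \<subseteq> bounded_degree_field l" using K_sub bounded_degree_field_mono[OF l(1)] by blast
  have "R.Span K Vs \<subseteq> bounded_degree_field l"
    using l(2)
  proof (induction Vs)
    case (Cons v Vs)
    then show ?case using K_sub' by (auto simp: R.line_extension_mem_iff subset_iff)
  qed simp
  then show ?thesis using Vs(1) by blast
qed

lemma radical_field_subset: "k \<ge> 1 \<Longrightarrow> radical_field k S \<subseteq> bounded_degree_field k"
  unfolding radical_field_def bounded_degree_field_eq
proof (intro adjoin_rat_mono subsetI)
  fix x :: 'a assume k: "k \<ge> 1" and "x \<in> {x. \<exists>p\<in>S. x ^ k = of_nat p}"
  then obtain p where "x ^ k = of_nat p" by auto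
  then have "poly (monom 1 k - [:of_nat p:]) x = 0" by (simp add: poly_monom)
  moreover have "monom 1 k - [:of_nat p:] \<in> polys (\<rat> :: 'a set)" by simp
  moreover have "coeff (monom 1 k - [:of_nat p:]) k = (1 :: 'a)"
    using k by (cases k) simp_all
  then have "monom 1 k - [:of_nat p:] \<noteq> (0 :: 'a poly)" by (metis coeff_0 zero_neq_one)
  moreover have "degree (monom 1 k - [:of_nat p:] :: 'a poly) \<le> k"
    by (intro degree_diff_le) (simp_all add: degree_monom_le)
  ultimately show "x \<in> {x. alg_deg_le k x}" unfolding alg_deg_le_def by blast
qed

theorem corollary37:
  fixes k :: nat and S :: "nat set"
    and Qk L :: "'a :: {alg_closed_field, field_char_0} set"
  assumes "k \<ge> 1"
    and "\<forall>p\<in>S. Factorial_Ring.prime p"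
    and "Qk = bounded_degree_field k"
    and "L = radical_field k S"
  shows "(rootless_field Qk \<and> (\<forall>E. finite_extension Qk E \<longrightarrow> rootless_field E))
       \<and> (rootless_field L \<and> (\<forall>E. finite_extension L E \<longrightarrow> rootless_field E))
       \<and> (field_good_heredity Qk \<and> (\<forall>E. finite_extension Qk E \<longrightarrow> field_good_heredity E))
       \<and> (field_good_heredity L \<and> (\<forall>E. finite_extension L E \<longrightarrow> field_good_heredity E))"
proof -
  have ext: "rootless_field E \<and> field_good_heredity E"
    if KE: "finite_extension K E" "K \<subseteq> bounded_degree_field k" for K E :: "'a set"
  proof -
    obtain l where "E \<subseteq> bounded_degree_field l"
      using finite_extension_in_bounded_degree_field[OF KE] by blast
    moreover have "subfield_ops E" using KE(1) by (simp add: finite_extension_def subfield_iff_ops)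
    ultimately show ?thesis using subfield_rootless subfield_good_heredity by blast
  qed
  have self: "rootless_field K \<and> field_good_heredity K"
    if "subfield_ops K" "K \<subseteq> bounded_degree_field k" for K :: "'a set"
    using that subfield_rootless subfield_good_heredity by blast
  have Qk: "subfield_ops Qk" "Qk \<subseteq> bounded_degree_field k"
    using bounded_degree_field_ops assms(3) by auto
  have L: "subfield_ops L" "L \<subseteq> bounded_degree_field k"
    using adjoin_rat_ops radical_field_subset assms(1,4) by (auto simp: radical_field_def)
  show ?thesis
    using self[OF Qk] self[OF L] ext[OF _ Qk(2)] ext[OF _ L(2)] by blast
qed

end
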